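(* Let $\mathsf{k}$ be an algebraically closed field (of any characteristic) and let $(\Lambda,\mathcal{M},W)$ be a Galois ring setting over $\mathsf{k}$ with $\Lambda$ an affine (finitely generated) $\mathsf{k}$-algebra and $\mathcal{M}$ a group; let $\Gamma=\Lambda^W$. Let $U$ be a Galois $\Gamma$-order, and let $\mathsf{m}$ be a maximal ideal of $\Gamma$ such that $\mathcal{M}_{\mathsf{m}}$ is finite. Then $\mathsf{Irred}(\mathsf{m})$ is finite and for every $\mathsf{M}\in\mathsf{Irred}(\mathsf{m})$ one has $\dim_{\mathsf{k}}\mathsf{M}^{\mathsf{m}}<\infty$.
   Context: All algebras are unital associative $\mathsf{k}$-algebras. A Galois ring setting is a triple $(\Lambda,\mathcal{M},W)$ where $\Lambda$ is a commutative Noetherian $\mathsf{k}$-algebra which is an integral domain, $\mathcal{M}$ is a submonoid of $\mathrm{Aut}_{\mathsf{k}}\Lambda$, and $W$ is a finite subgroup of $\mathrm{Aut}_{\mathsf{k}}\Lambda$ acting on $\mathcal{M}$ by conjugation (so $w\mathcal{M}w^{-1}=\mathcal{M}$ for $w\in W$), such that $\mathcal{M}$ is separating: $\mathcal{M}\mathcal{M}^{-1}\cap W=\{e\}$. No assumption is made on $|W|$ and the characteristic of $\mathsf{k}$. Put $L=\mathrm{Frac}\,\Lambda$ and let $\mathcal{L}=L*\mathcal{M}$ be the skew monoid ring: the free left $L$-module on $\mathcal{M}$ with $(l\mu)(l'\nu)=l\mu(l')\,\mu\nu$. The group $W$ acts on $\mathcal{L}$ by $w(\sum l_\mu\mu)=\sum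 w(l_\mu)\,w\mu w^{-1}$. Put $\mathcal{K}=\mathcal{L}^W$, $\Gamma=\Lambda^W$, $K=\mathrm{Frac}\,\Gamma=L^W$. A Galois $\Gamma$-ring in $\mathcal{K}$ is a subalgebra $U\subset\mathcal{K}$ such that $\Lambda$ is a Noetherian $\Gamma$-module, $\Gamma\subset U$, and $KU=\mathcal{K}$. A Galois $\Gamma$-ring $U$ is a Galois order if for every finite-dimensional left or right $K$-vector subspace $V$ of $\mathcal{K}$, $U\cap V$ is finitely generated as a left and as a right $\Gamma$-module. A Harish-Chandra module for $(U,\Gamma)$ is a finitely generated $U$-module $M$ on which $\Gamma$ acts locally finitely, equivalently $M=\bigoplus_{\mathsf{n}\in\mathrm{SpecMax}\,\Gamma}M^{\mathsf{n}}$ where $M^{\mathsf{n}}=\{v\in M\mid \mathsf{n}^{N}v=0 \text{ for } N\gg0\}$. Its support is the set of $\mathsf{n}$ with $M^{\mathsf{n}}\neq0$. $\mathsf{Irred}(\mathsf{m})$ is the set of isomorphism classes of irreducible Harish-Chandra modules having $\mathsf{m}$ in their support. For a maximal ideal $\mathsf{m}$ of $\Gamma$, choose a maximal ideal $\mathfrak{M}$ of $\Lambda$ lying over $\mathsf{m}$; $\mathcal{M}_{\mathsf{m}}=\{\mu\in\mathcal{M}\mid\mu(\mathfrak{M})=\mathfrak{M}\}$. Its finiteness does not depend on the choice of $\mathfrak{M}$, since $\mathfrak{M}$ is unique up to the action of $W$. *)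

theory Defs
  imports
    "HOL-Algebra.Algebra"
    "HOL-Algebra.Algebraic_Closure_Type"
    "HOL-Computational_Algebra.Computational_Algebra"
begin

section \<open>Modules over not necessarily commutative rings\<close>

text \<open>The locale \<^locale>\<open>module\<close> requires a commutative ring of scalars; the
  locale \<^locale>\<open>submodule\<close> and the record type do not, and are used below.\<close>

locale left_module = R?: ring R + E?: abelian_group E
  for R :: "('r, 'p) ring_scheme" (structure)
    and E :: "('r, 'm, 'q) module_scheme" (structure) +
  assumes smult_closed: "\<lbrakk>a \<in> carrier R; x \<in> carrier E\<rbrakk> \<Longrightarrow> a \<odot>\<^bsub>E\<^esub> x \<in> carrier E"
    and smult_l_distr: "\<lbrakk>a \<in> carrier R; b \<in> carrier R; x \<in> carrier E\<rbrakk>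
      \<Longrightarrow> (a \<oplus>\<^bsub>R\<^esub> b) \<odot>\<^bsub>E\<^esub> x = a \<odot>\<^bsub>E\<^esub> x \<oplus>\<^bsub>E\<^esub> b \<odot>\<^bsub>E\<^esub> x"
    and smult_r_distr: "\<lbrakk>a \<in> carrier R; x \<in> carrier E; y \<in> carrier E\<rbrakk>
      \<Longrightarrow> a \<odot>\<^bsub>E\<^esub> (x \<oplus>\<^bsub>E\<^esub> y) = a \<odot>\<^bsub>E\<^esub> x \<oplus>\<^bsub>E\<^esub> a \<odot>\<^bsub>E\<^esub> y"
    and smult_assoc: "\<lbrakk>a \<in> carrier R; b \<in> carrier R; x \<in> carrier E\<rbrakk>
      \<Longrightarrow> (a \<otimes>\<^bsub>R\<^esub> b) \<odot>\<^bsub>E\<^esub> x = a \<odot>\<^bsub>E\<^esub> (b \<odot>\<^bsub>E\<^esub> x)"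
    and smult_one: "x \<in> carrier E \<Longrightarrow> \<one>\<^bsub>R\<^esub> \<odot>\<^bsub>E\<^esub> x = x"

definition mod_span :: "('r, 'p) ring_scheme \<Rightarrow> ('r, 'm, 'q) module_scheme \<Rightarrow> 'm set \<Rightarrow> 'm set" where
  "mod_span R E S = \<Inter> {N. submodule N R E \<and> S \<subseteq> N}"

text \<open>When the scalars form a field, \<open>fin_gen\<close> says that the subspace is finite-dimensional.\<close>

definition fin_gen :: "('r, 'p) ring_scheme \<Rightarrow> ('r, 'm, 'q) module_scheme \<Rightarrow> 'm set \<Rightarrow> bool" where
  "fin_gen R E N \<longleftrightarrow> (\<exists>S. finite S \<and> S \<subseteq> carrier E \<and> N = mod_span R E S)"

definition noetherian_module :: "('r, 'p) ring_scheme \<Rightarrow> ('r, 'm, 'q) module_scheme \<Rightarrow> bool" where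
  "noetherian_module R E \<longleftrightarrow> (\<forall>N. submodule N R E \<longrightarrow> fin_gen R E N)"

definition irreducible_module :: "('r, 'p) ring_scheme \<Rightarrow> ('r, 'm, 'q) module_scheme \<Rightarrow> bool" where
  "irreducible_module R E \<longleftrightarrow> carrier E \<noteq> {\<zero>\<^bsub>E\<^esub>} \<and>
     (\<forall>N. submodule N R E \<longrightarrow> N = {\<zero>\<^bsub>E\<^esub>} \<or> N = carrier E)"

definition module_isomorphic ::
  "('r, 'p) ring_scheme \<Rightarrow> ('r, 'm, 'q) module_scheme \<Rightarrow> ('r, 'n, 's) module_scheme \<Rightarrow> bool" where
  "module_isomorphic R E F \<longleftrightarrow> (\<exists>f \<in> iso (add_monoid E) (add_monoid F).
     \<forall>r \<in> carrier R. \<forall>x \<in> carrier E. f (r \<odot>\<^bsub>E\<^esub> x) = r \<odot>\<^bsub>F\<^esub> f x)"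

text \<open>The additive group of \<open>A\<close> with a new scalar multiplication.\<close>

definition with_scalars :: "('m, 'q) ring_scheme \<Rightarrow> ('r \<Rightarrow> 'm \<Rightarrow> 'm) \<Rightarrow> ('r, 'm) module" where
  "with_scalars A s = \<lparr>carrier = carrier A, monoid.mult = monoid.mult A, one = monoid.one A,
     ring.zero = ring.zero A, add = add A, module.smult = s\<rparr>"


section \<open>Galois ring settings\<close>

locale comm_k_algebra = vector_space scale
  for scale :: "'k::field \<Rightarrow> 'a::comm_ring_1 \<Rightarrow> 'a" +
  assumes scale_mult_left: "scale c (x * y) = scale c x * y"

definition subalgebra_of :: "('k::field \<Rightarrow> 'a::comm_ring_1 \<Rightarrow> 'a) \<Rightarrow> 'a set \<Rightarrow> bool" where
  "subalgebra_of scale A \<longleftrightarrow>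
     subring A (ring_of_type_algebra :: 'a ring) \<and> (\<forall>c. \<forall>a\<in>A. scale c a \<in> A)"

definition affine_algebra :: "('k::field \<Rightarrow> 'a::comm_ring_1 \<Rightarrow> 'a) \<Rightarrow> bool" where
  "affine_algebra scale \<longleftrightarrow>
     (\<exists>S. finite S \<and> (\<forall>A. subalgebra_of scale A \<and> S \<subseteq> A \<longrightarrow> A = UNIV))"

definition alg_aut :: "('k::field \<Rightarrow> 'a::comm_ring_1 \<Rightarrow> 'a) \<Rightarrow> ('a \<Rightarrow> 'a) monoid" where
  "alg_aut scale = \<lparr>carrier = {f. bij f \<and> Vector_Spaces.linear scale scale f \<and>
       f 1 = 1 \<and> (\<forall>x y. f (x * y) = f x * f y)},
     monoid.mult = (\<circ>), one = id\<rparr>"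

text \<open>\<open>\<Lambda>\<close> is the whole type \<open>'a\<close>; \<open>inv_into UNIV f\<close> is the inverse of a bijection \<open>f\<close>
  (the notation \<open>inv\<close> is taken by \<^const>\<open>m_inv\<close>).\<close>

locale galois_ring_setting = comm_k_algebra scale
  for scale :: "'k::field \<Rightarrow> 'a::idom \<Rightarrow> 'a" +
  fixes M W :: "('a \<Rightarrow> 'a) set"
  assumes noetherian: "noetherian_ring (ring_of_type_algebra :: 'a ring)"
    and submonoid_M: "submonoid M (alg_aut scale)"
    and subgroup_W: "subgroup W (alg_aut scale)"
    and finite_W: "finite W"
    and conj_M: "\<And>w. w \<in> W \<Longrightarrow> (\<lambda>\<mu>. w \<circ> \<mu> \<circ> inv_into UNIV w) ` M = M"
    and separating: "{\<mu> \<circ> inv_into UNIV \<nu> | \<mu> \<nu>. \<mu> \<in> M \<and> \<nu> \<in> M} \<inter> W = {id}"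

definition Gamma :: "('a \<Rightarrow> 'a) set \<Rightarrow> 'a set" where
  "Gamma W = {a. \<forall>w\<in>W. w a = a}"

definition Gamma_ring :: "('a::comm_ring_1 \<Rightarrow> 'a) set \<Rightarrow> 'a ring" where
  "Gamma_ring W = ring_of_type_algebra\<lparr>carrier := Gamma W\<rparr>"

text \<open>\<open>K = Frac \<Gamma>\<close>, as a subfield of \<open>L = Frac \<Lambda>\<close>.\<close>

definition K_ring :: "('a::idom \<Rightarrow> 'a) set \<Rightarrow> 'a fract ring" where
  "K_ring W = ring_of_type_algebra
     \<lparr>carrier := {Fract a b | a b. a \<in> Gamma W \<and> b \<in> Gamma W \<and> b \<noteq> 0}\<rparr>"


section \<open>The skew monoid ring and its invariants\<close>

text \<open>The extension of an automorphism of \<open>\<Lambda>\<close> to \<open>L\<close>.\<close>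

definition frac_map :: "('a::idom \<Rightarrow> 'a) \<Rightarrow> 'a fract \<Rightarrow> 'a fract" where
  "frac_map f q = (THE r. \<forall>a b. b \<noteq> 0 \<and> q = Fract a b \<longrightarrow> r = Fract (f a) (f b))"

lemma frac_map_Fract:
  fixes f :: "'a::idom \<Rightarrow> 'a"
  assumes "inj f" and "\<And>x y. f (x * y) = f x * f y" and "f 0 = 0" and "b \<noteq> 0"
  shows "frac_map f (Fract a b) = Fract (f a) (f b)"
proof -
  have nz: "f x \<noteq> 0" if "x \<noteq> 0" for x
    using that assms(1,3) by (metis injD)
  have eq: "Fract (f a) (f b) = Fract (f c) (f d)" if "d \<noteq> 0" "Fract a b = Fract c d" for c d
  proof -
    have "a * d = c * b"
      using that assms(4) by (simp add: eq_fract)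
    then have "f a * f d = f c * f b"
      by (metis assms(2))
    then show ?thesis
      using nz[OF that(1)] nz[OF assms(4)] by (simp add: eq_fract)
  qed
  show ?thesis
    unfolding frac_map_def
  proof (rule the_equality)
    show "\<forall>c d. d \<noteq> 0 \<and> Fract a b = Fract c d \<longrightarrow> Fract (f a) (f b) = Fract (f c) (f d)"
      using eq by blast
  next
    fix r
    assume "\<forall>c d. d \<noteq> 0 \<and> Fract a b = Fract c d \<longrightarrow> r = Fract (f c) (f d)"
    then show "r = Fract (f a) (f b)"
      using assms(4) by blast
  qed
qed

text \<open>An element \<open>\<Sum> l\<^sub>\<mu> \<mu>\<close> of \<open>L * M\<close> is the function \<open>\<mu> \<mapsto> l\<^sub>\<mu>\<close>,
  which has finite support contained in \<open>M\<close>.\<close>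

type_synonym 'a skew = "('a \<Rightarrow> 'a) \<Rightarrow> 'a fract"

definition supp :: "'a::idom skew \<Rightarrow> ('a \<Rightarrow> 'a) set" where
  "supp x = {\<mu>. x \<mu> \<noteq> 0}"

definition coeff_emb :: "'a::idom fract \<Rightarrow> 'a skew" where
  "coeff_emb l = (\<lambda>\<mu>. if \<mu> = id then l else 0)"

definition skew_ring :: "('a::idom \<Rightarrow> 'a) set \<Rightarrow> 'a skew ring" where
  "skew_ring M = \<lparr>carrier = {x. finite (supp x) \<and> supp x \<subseteq> M},
     monoid.mult = (\<lambda>x y \<rho>. \<Sum>\<mu>\<in>supp x. \<Sum>\<nu>\<in>supp y.
       if \<mu> \<circ> \<nu> = \<rho> then x \<mu> * frac_map \<mu> (y \<nu>) else 0),
     one = coeff_emb 1,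
     ring.zero = (\<lambda>\<rho>. 0),
     add = (\<lambda>x y \<rho>. x \<rho> + y \<rho>)\<rparr>"

text \<open>\<open>w (\<Sum> l\<^sub>\<mu> \<mu>) = \<Sum> w(l\<^sub>\<mu>) w \<mu> w\<inverse>\<close>, whose coefficient at \<open>\<rho>\<close> is \<open>w(l\<^sub>\<mu>)\<close>
  for \<open>\<mu> = w\<inverse> \<rho> w\<close>.\<close>

definition W_act :: "('a::idom \<Rightarrow> 'a) \<Rightarrow> 'a skew \<Rightarrow> 'a skew" where
  "W_act w x = (\<lambda>\<rho>. frac_map w (x (inv_into UNIV w \<circ> \<rho> \<circ> w)))"

text \<open>The invariant ring \<open>(L * M)\<^sup>W\<close>.\<close>

definition KK_ring :: "('a::idom \<Rightarrow> 'a) set \<Rightarrow> ('a \<Rightarrow> 'a) set \<Rightarrow> 'a skew ring" where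
  "KK_ring M W = (skew_ring M)
     \<lparr>carrier := {x \<in> carrier (skew_ring M). \<forall>w\<in>W. W_act w x = x}\<rparr>"

definition Gamma_emb :: "'a::idom \<Rightarrow> 'a skew" where
  "Gamma_emb a = coeff_emb (to_fract a)"

definition k_emb :: "('k::field \<Rightarrow> 'a::idom \<Rightarrow> 'a) \<Rightarrow> 'k \<Rightarrow> 'a skew" where
  "k_emb scale c = Gamma_emb (scale c 1)"

definition left_KK :: "('a::idom \<Rightarrow> 'a) set \<Rightarrow> ('a \<Rightarrow> 'a) set \<Rightarrow> ('r \<Rightarrow> 'a skew) \<Rightarrow> ('r, 'a skew) module" where
  "left_KK M W h = with_scalars (KK_ring M W) (\<lambda>r x. h r \<otimes>\<^bsub>KK_ring M W\<^esub> x)"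

text \<open>A right module over a commutative ring (here \<open>K\<close> or \<open>\<Gamma>\<close>) is the same as a module
  over that ring, so right structures are also encoded by \<^typ>\<open>('r, 'm) module\<close>.\<close>

definition right_KK :: "('a::idom \<Rightarrow> 'a) set \<Rightarrow> ('a \<Rightarrow> 'a) set \<Rightarrow> ('r \<Rightarrow> 'a skew) \<Rightarrow> ('r, 'a skew) module" where
  "right_KK M W h = with_scalars (KK_ring M W) (\<lambda>r x. x \<otimes>\<^bsub>KK_ring M W\<^esub> h r)"


section \<open>Galois rings and Galois orders\<close>

text \<open>\<open>K U\<close> is the left \<open>K\<close>-subspace spanned by \<open>U\<close>.\<close>

definition galois_ring ::
  "('k::field \<Rightarrow> 'a::idom \<Rightarrow> 'a) \<Rightarrow> ('a \<Rightarrow> 'a) set \<Rightarrow> ('a \<Rightarrow> 'a) set \<Rightarrow> 'a skew set \<Rightarrow> bool" where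
  "galois_ring scale M W U \<longleftrightarrow>
     subring U (KK_ring M W) \<and>
     (\<forall>c. \<forall>u\<in>U. k_emb scale c \<otimes>\<^bsub>KK_ring M W\<^esub> u \<in> U) \<and>
     noetherian_module (Gamma_ring W) (with_scalars (ring_of_type_algebra :: 'a ring) (*)) \<and>
     Gamma_emb ` Gamma W \<subseteq> U \<and>
     mod_span (K_ring W) (left_KK M W coeff_emb) U = carrier (KK_ring M W)"

text \<open>If \<open>V\<close> is a left subspace then \<open>U \<inter> V\<close> is a left \<open>\<Gamma>\<close>-submodule but need not be stable
  under \<open>\<Gamma>\<close> on the right (and conversely).  Finite generation of \<open>U \<inter> V\<close> as a left (right)
  \<open>\<Gamma>\<close>-module therefore refers to the left (right) \<open>\<Gamma>\<close>-submodule generated by \<open>U \<inter> V\<close>,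
  which is \<open>U \<inter> V\<close> itself on the side where it is stable.  Since every \<open>K v K\<close> with
  \<open>v \<in> (L * M)\<^sup>W\<close> is finite-dimensional on both sides and \<open>\<Gamma>\<close> is Noetherian, the condition on
  the other side follows from the one-sided conditions (\<open>V\<close> left, \<open>\<Gamma>\<close> left; \<open>V\<close> right,
  \<open>\<Gamma>\<close> right).\<close>

definition galois_order ::
  "('k::field \<Rightarrow> 'a::idom \<Rightarrow> 'a) \<Rightarrow> ('a \<Rightarrow> 'a) set \<Rightarrow> ('a \<Rightarrow> 'a) set \<Rightarrow> 'a skew set \<Rightarrow> bool" where
  "galois_order scale M W U \<longleftrightarrow> galois_ring scale M W U \<and>
     (\<forall>V. (submodule V (K_ring W) (left_KK M W coeff_emb) \<and>
             fin_gen (K_ring W) (left_KK M W coeff_emb) V) \<or>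
           (submodule V (K_ring W) (right_KK M W coeff_emb) \<and>
             fin_gen (K_ring W) (right_KK M W coeff_emb) V) \<longrightarrow>
        fin_gen (Gamma_ring W) (left_KK M W Gamma_emb)
          (mod_span (Gamma_ring W) (left_KK M W Gamma_emb) (U \<inter> V)) \<and>
        fin_gen (Gamma_ring W) (right_KK M W Gamma_emb)
          (mod_span (Gamma_ring W) (right_KK M W Gamma_emb) (U \<inter> V)))"


section \<open>Harish-Chandra modules\<close>

definition U_ring :: "('a::idom \<Rightarrow> 'a) set \<Rightarrow> 'a skew set \<Rightarrow> 'a skew ring" where
  "U_ring M U = (skew_ring M)\<lparr>carrier := U\<rparr>"

text \<open>Restriction of scalars of a \<open>U\<close>-module to \<open>k \<subseteq> U\<close>.\<close>

definition k_space ::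
  "('k::field \<Rightarrow> 'a::idom \<Rightarrow> 'a) \<Rightarrow> ('a skew, 'm, 'q) module_scheme \<Rightarrow> ('k, 'm) module" where
  "k_space scale E = with_scalars E (\<lambda>c v. k_emb scale c \<odot>\<^bsub>E\<^esub> v)"

definition finite_dim_k ::
  "('k::field \<Rightarrow> 'a::idom \<Rightarrow> 'a) \<Rightarrow> ('a skew, 'm, 'q) module_scheme \<Rightarrow> 'm set \<Rightarrow> bool" where
  "finite_dim_k scale E V \<longleftrightarrow>
     fin_gen (ring_of_type_algebra :: 'k ring) (k_space scale E) V"

definition harish_chandra_module :: "('k::field \<Rightarrow> 'a::idom \<Rightarrow> 'a) \<Rightarrow> ('a \<Rightarrow> 'a) set \<Rightarrow>
    ('a \<Rightarrow> 'a) set \<Rightarrow> 'a skew set \<Rightarrow> ('a skew, 'm, 'q) module_scheme \<Rightarrow> bool" where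
  "harish_chandra_module scale M W U E \<longleftrightarrow>
     left_module (U_ring M U) E \<and>
     fin_gen (U_ring M U) E (carrier E) \<and>
     (\<forall>v\<in>carrier E. finite_dim_k scale E ((\<lambda>\<gamma>. Gamma_emb \<gamma> \<odot>\<^bsub>E\<^esub> v) ` Gamma W))"

text \<open>Powers of ideals of \<open>\<Gamma>\<close> are taken in the multiplicative monoid of ideals.\<close>

definition weight_space ::
  "('a::idom \<Rightarrow> 'a) set \<Rightarrow> ('a skew, 'm, 'q) module_scheme \<Rightarrow> 'a set \<Rightarrow> 'm set" where
  "weight_space W E n = {v \<in> carrier E.
     \<exists>N0. \<forall>N\<ge>N0. \<forall>a \<in> n [^]\<^bsub>ideals_set (Gamma_ring W)\<^esub> (N::nat). Gamma_emb a \<odot>\<^bsub>E\<^esub> v = \<zero>\<^bsub>E\<^esub>}"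

definition module_support ::
  "('a::idom \<Rightarrow> 'a) set \<Rightarrow> ('a skew, 'm, 'q) module_scheme \<Rightarrow> 'a set set" where
  "module_support W E = {n. maximalideal n (Gamma_ring W) \<and> weight_space W E n \<noteq> {\<zero>\<^bsub>E\<^esub>}}"

text \<open>The modules live on subsets of a type \<open>'m\<close>.  An irreducible \<open>U\<close>-module is isomorphic to a
  set of cosets of a left ideal of \<open>U\<close>, so statements for all types \<open>'m\<close> cover, up to
  isomorphism, all irreducible modules simultaneously.\<close>

definition irred_HC_modules :: "('k::field \<Rightarrow> 'a::idom \<Rightarrow> 'a) \<Rightarrow> ('a \<Rightarrow> 'a) set \<Rightarrow>
    ('a \<Rightarrow> 'a) set \<Rightarrow> 'a skew set \<Rightarrow> 'a set \<Rightarrow> ('a skew, 'm) module set" where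
  "irred_HC_modules scale M W U n = {E. harish_chandra_module scale M W U E \<and>
     irreducible_module (U_ring M U) E \<and> n \<in> module_support W E}"

definition Irred :: "('k::field \<Rightarrow> 'a::idom \<Rightarrow> 'a) \<Rightarrow> ('a \<Rightarrow> 'a) set \<Rightarrow>
    ('a \<Rightarrow> 'a) set \<Rightarrow> 'a skew set \<Rightarrow> 'a set \<Rightarrow> ('a skew, 'm) module set set" where
  "Irred scale M W U n = irred_HC_modules scale M W U n //
     {(E, F). E \<in> irred_HC_modules scale M W U n \<and> F \<in> irred_HC_modules scale M W U n \<and>
        module_isomorphic (U_ring M U) E F}"

text \<open>\<open>M\<^sub>m\<close>, for a maximal ideal \<open>P\<close> of \<open>\<Lambda>\<close> lying over \<open>m\<close>.\<close>

definition stabilizer_in :: "('a \<Rightarrow> 'a) set \<Rightarrow> 'a set \<Rightarrow> ('a \<Rightarrow> 'a) set" where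
  "stabilizer_in M P = {\<mu> \<in> M. \<mu> ` P = P}"

end

theory Submission
  imports Defs "HOL-Library.Function_Algebras"
begin

text \<open>The elements of \<open>U\<close> supported on the finite set \<open>S\<^sub>0\<close> of those \<open>\<mu> \<in> M\<close> that map some
  prime of \<open>\<Lambda>\<close> over \<open>m\<close> to a prime over \<open>m\<close> form, by the order condition, a finitely generated
  right \<open>\<Gamma>\<close>-module \<open>U\<^sub>0\<close>.  If \<open>m v = 0\<close>, any \<open>u \<in> U\<close> can be corrected to some \<open>u' \<in> U\<^sub>0\<close> with
  \<open>u' v = g u v\<close>, where \<open>g \<in> \<Gamma>\<close> lies outside \<open>m\<close> and is therefore invertible on the weight space
  of \<open>m\<close>: choose \<open>\<gamma> \<in> m\<close> with \<open>s \<gamma> \<notin> P\<close> for all \<open>s \<in> supp u - S\<^sub>0\<close> and take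
  \<open>u' = \<Sum>\<^sub>i c\<^sub>i u \<gamma>\<^sup>i\<close>, where \<open>\<Prod>\<^sub>s (X - s \<gamma>) = \<Sum>\<^sub>i c\<^sub>i X\<^sup>i\<close>, so that \<open>g = c\<^sub>0\<close>.  As \<open>\<Gamma>\<close> acts on \<open>v\<close>
  through \<open>\<Gamma>/m = k\<close>, the weight space of an irreducible module \<open>U v\<close> is contained in the span of
  \<open>t v\<close>, with \<open>t\<close> in a finite set \<open>T\<close> that does not depend on the module.  For pairwise
  non-isomorphic irreducible modules \<open>U v\<^sub>i\<close> there are \<open>e\<^sub>i \<in> U\<close> with \<open>e\<^sub>i v\<^sub>j = \<delta>\<^sub>i\<^sub>j v\<^sub>j\<close>; correcting
  them in the same way gives linearly independent elements of the span of \<open>T\<close>, so there are at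
  most \<open>|T|\<close> such modules.\<close>

section \<open>Simple modules and prime avoidance\<close>

text \<open>If no member of \<open>A\<close> can be omitted from the cover and there are at least
  two, choose \<open>a Q\<close> in \<open>I\<close> that lies in \<open>Q\<close> and in no other
  member; the sum of one of these and the product of all the others then lies in no member at all.
  \<open>I\<close> is only required to be closed under sums and products, so that it may be an ideal
  of a subring.\<close>

lemma prime_avoidance:
  fixes I :: "'a::comm_ring_1 set"
  assumes "finite A" and ne: "I \<noteq> {}" and cover: "I \<subseteq> \<Union>A"
    and I_add: "\<And>x y. x \<in> I \<Longrightarrow> y \<in> I \<Longrightarrow> x + y \<in> I"
    and I_mult: "\<And>x y. x \<in> I \<Longrightarrow> y \<in> I \<Longrightarrow> x * y \<in> I"
    and Q_add: "\<And>Q x y. Q \<in> A \<Longrightarrow> x \<in> Q \<Longrightarrow> x + y \<in> Q \<Longrightarrow> y \<in> Q"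
    and Q_mult: "\<And>Q x y. Q \<in> A \<Longrightarrow> x \<in> Q \<Longrightarrow> x * y \<in> Q"
    and Q_prime: "\<And>Q x y. Q \<in> A \<Longrightarrow> x * y \<in> Q \<Longrightarrow> x \<in> Q \<or> y \<in> Q"
  shows "\<exists>Q\<in>A. I \<subseteq> Q"
  using assms(1) cover Q_add Q_mult Q_prime
proof (induction "card A" arbitrary: A rule: less_induct)
  case less
  note prems = less.prems
  show ?case
  proof (cases "\<exists>Q\<in>A. I \<subseteq> \<Union>(A - {Q})")
    case True
    then obtain Q where Q: "Q \<in> A" "I \<subseteq> \<Union>(A - {Q})"
      by blast
    have "\<exists>Q'\<in>A - {Q}. I \<subseteq> Q'"
    proof (rule less.hyps)
      show "card (A - {Q}) < card A"
        using Q(1) prems(1) by (rule card_Diff1_less[rotated])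
      show "finite (A - {Q})" "I \<subseteq> \<Union>(A - {Q})"
        using prems(1) Q(2) by simp_all
      show "y \<in> Q'" if "Q' \<in> A - {Q}" "x \<in> Q'" "x + y \<in> Q'" for Q' x y
        using prems(3)[of Q' x y] that by simp
      show "x * y \<in> Q'" if "Q' \<in> A - {Q}" "x \<in> Q'" for Q' x y
        using prems(4)[of Q' x y] that by simp
      show "x \<in> Q' \<or> y \<in> Q'" if "Q' \<in> A - {Q}" "x * y \<in> Q'" for Q' x y
        using prems(5)[of Q' x y] that by simp
    qed
    then show ?thesis
      by blast
  next
    case False
    then have "\<forall>Q\<in>A. \<exists>x. x \<in> I \<and> x \<notin> \<Union>(A - {Q})"
      by blast
    then obtain a where a: "\<And>Q. Q \<in> A \<Longrightarrow> a Q \<in> I \<and> a Q \<notin> \<Union>(A - {Q})"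
      by metis
    have aQ: "a Q \<in> Q" if "Q \<in> A" for Q
      using a[OF that] prems(2) by blast
    obtain Q1 where Q1: "Q1 \<in> A"
      using ne prems(2) by blast
    define B where "B = A - {Q1}"
    have fB: "finite B"
      using prems(1) by (simp add: B_def)
    show ?thesis
    proof (cases "B = {}")
      case True
      then have "A = {Q1}"
        using Q1 by (auto simp: B_def)
      then show ?thesis
        using prems(2) by blast
    next
      case False
      have "prod a B \<in> I \<and> prod a B \<notin> Q1"
        if "finite B" "B \<noteq> {}" "B \<subseteq> A - {Q1}" for B
        using that
      proof (induction B rule: finite_ne_induct)
        case (singleton Q)
        then show ?case
          using a Q1 by auto
      next
        case (insert Q F)
        then have "a Q \<notin> Q1"
          using a[of Q] Q1 by blast
        then show ?case
          using insert a[of Q] I_mult prems(5)[OF Q1, of "a Q" "prod a F"] by auto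
      qed
      then have y: "prod a B \<in> I" "prod a B \<notin> Q1"
        using fB False by (auto simp: B_def)
      have "a Q1 + prod a B \<in> I"
        using a[OF Q1] y I_add by blast
      then obtain Q where Q: "Q \<in> A" "a Q1 + prod a B \<in> Q"
        using prems(2) by blast
      show ?thesis
      proof (cases "Q = Q1")
        case True
        then show ?thesis
          using prems(3)[OF Q1 aQ[OF Q1]] Q y by blast
      next
        case neq: False
        then have "Q \<in> B"
          using Q by (simp add: B_def)
        then have "prod a B = a Q * prod a (B - {Q})"
          using fB by (simp add: prod.remove)
        then have "prod a B \<in> Q"
          using prems(4)[OF Q(1) aQ[OF Q(1)]] by simp
        then have "a Q1 \<in> Q"
          using prems(3)[OF Q(1), of "prod a B" "a Q1"] Q(2) by (simp add: add.commute)
        then show ?thesis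
          using a[OF Q1] Q(1) neq by blast
      qed
    qed
  qed
qed

section \<open>Left ideals and irreducible modules\<close>

context left_module
begin

lemma smult_l_null: "x \<in> carrier E \<Longrightarrow> \<zero>\<^bsub>R\<^esub> \<odot>\<^bsub>E\<^esub> x = \<zero>\<^bsub>E\<^esub>"
  using smult_l_distr[of "\<zero>\<^bsub>R\<^esub>" "\<zero>\<^bsub>R\<^esub>" x] smult_closed[of "\<zero>\<^bsub>R\<^esub>" x]
  by (metis E.add.l_cancel_one' R.add.one_closed R.l_zero)

lemma smult_r_null: "a \<in> carrier R \<Longrightarrow> a \<odot>\<^bsub>E\<^esub> \<zero>\<^bsub>E\<^esub> = \<zero>\<^bsub>E\<^esub>"
  using smult_r_distr[of a "\<zero>\<^bsub>E\<^esub>" "\<zero>\<^bsub>E\<^esub>"] smult_closed[of a "\<zero>\<^bsub>E\<^esub>"]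
  by (metis E.add.l_cancel_one' E.add.one_closed E.l_zero)

lemma smult_l_minus:
  assumes "a \<in> carrier R" "x \<in> carrier E"
  shows "(\<ominus>\<^bsub>R\<^esub> a) \<odot>\<^bsub>E\<^esub> x = \<ominus>\<^bsub>E\<^esub> (a \<odot>\<^bsub>E\<^esub> x)"
proof -
  have "(\<ominus>\<^bsub>R\<^esub> a) \<odot>\<^bsub>E\<^esub> x \<oplus>\<^bsub>E\<^esub> a \<odot>\<^bsub>E\<^esub> x = \<zero>\<^bsub>E\<^esub>"
    using assms by (metis R.add.inv_closed R.l_neg smult_l_distr smult_l_null)
  then show ?thesis
    using assms by (simp add: E.minus_equality smult_closed)
qed

lemma smult_eq_iff:
  assumes "r \<in> carrier R" "s \<in> carrier R" "z \<in> carrier E"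
  shows "r \<odot>\<^bsub>E\<^esub> z = s \<odot>\<^bsub>E\<^esub> z \<longleftrightarrow> (r \<ominus>\<^bsub>R\<^esub> s) \<odot>\<^bsub>E\<^esub> z = \<zero>\<^bsub>E\<^esub>"
proof -
  have "(r \<ominus>\<^bsub>R\<^esub> s) \<odot>\<^bsub>E\<^esub> z = r \<odot>\<^bsub>E\<^esub> z \<ominus>\<^bsub>E\<^esub> s \<odot>\<^bsub>E\<^esub> z"
    using assms by (simp add: a_minus_def smult_l_distr smult_l_minus)
  then show ?thesis
    using assms
    by (metis E.a_inv_closed E.minus_equality E.minus_minus E.r_neg smult_closed a_minus_def)
qed

text \<open>Negatives come for free, as multiples by the negative of the unit.\<close>

lemma submodule_if_closed:
  assumes "N \<subseteq> carrier E" "\<zero>\<^bsub>E\<^esub> \<in> N"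
    and "\<And>x y. x \<in> N \<Longrightarrow> y \<in> N \<Longrightarrow> x \<oplus>\<^bsub>E\<^esub> y \<in> N"
    and smult: "\<And>a x. a \<in> carrier R \<Longrightarrow> x \<in> N \<Longrightarrow> a \<odot>\<^bsub>E\<^esub> x \<in> N"
  shows "submodule N R E"
proof (intro submodule.intro subgroup.intro submodule_axioms.intro)
  show "inv\<^bsub>add_monoid E\<^esub> x \<in> N" if "x \<in> N" for x
  proof -
    have "\<ominus>\<^bsub>E\<^esub> x = (\<ominus>\<^bsub>R\<^esub> \<one>\<^bsub>R\<^esub>) \<odot>\<^bsub>E\<^esub> x"
      using that assms(1) by (simp add: smult_l_minus smult_one subset_iff)
    then show ?thesis
      using smult[OF _ that] by (simp add: a_inv_def)
  qed
qed (use assms in auto)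

text \<open>The conditions on \<open>A\<close> say that it is a left ideal; below, \<open>A\<close>
  is the whole ring or a set of elements annihilating given vectors.\<close>

lemma submodule_image:
  assumes "A \<subseteq> carrier R" "\<zero>\<^bsub>R\<^esub> \<in> A"
    and "\<And>r s. r \<in> A \<Longrightarrow> s \<in> A \<Longrightarrow> r \<oplus>\<^bsub>R\<^esub> s \<in> A"
    and "\<And>r s. r \<in> carrier R \<Longrightarrow> s \<in> A \<Longrightarrow> r \<otimes>\<^bsub>R\<^esub> s \<in> A"
    and v: "v \<in> carrier E"
  shows "submodule ((\<lambda>r. r \<odot>\<^bsub>E\<^esub> v) ` A) R E"
proof (rule submodule_if_closed)
  show "(\<lambda>r. r \<odot>\<^bsub>E\<^esub> v) ` A \<subseteq> carrier E"
    using assms smult_closed by blast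
  show "\<zero>\<^bsub>E\<^esub> \<in> (\<lambda>r. r \<odot>\<^bsub>E\<^esub> v) ` A"
    using assms smult_l_null by force
next
  fix x y
  assume "x \<in> (\<lambda>r. r \<odot>\<^bsub>E\<^esub> v) ` A" "y \<in> (\<lambda>r. r \<odot>\<^bsub>E\<^esub> v) ` A"
  then obtain r s where "r \<in> A" "s \<in> A" "x = r \<odot>\<^bsub>E\<^esub> v" "y = s \<odot>\<^bsub>E\<^esub> v"
    by blast
  then have "x \<oplus>\<^bsub>E\<^esub> y = (r \<oplus>\<^bsub>R\<^esub> s) \<odot>\<^bsub>E\<^esub> v" "r \<oplus>\<^bsub>R\<^esub> s \<in> A"
    using assms(1,3) smult_l_distr[OF _ _ v, of r s] by (auto simp: subset_iff)
  then show "x \<oplus>\<^bsub>E\<^esub> y \<in> (\<lambda>r. r \<odot>\<^bsub>E\<^esub> v) ` A"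
    by blast
next
  fix a x
  assume a: "a \<in> carrier R" and "x \<in> (\<lambda>r. r \<odot>\<^bsub>E\<^esub> v) ` A"
  then obtain r where r: "r \<in> A" "x = r \<odot>\<^bsub>E\<^esub> v"
    by blast
  then have "a \<odot>\<^bsub>E\<^esub> x = (a \<otimes>\<^bsub>R\<^esub> r) \<odot>\<^bsub>E\<^esub> v"
    using assms a smult_assoc by auto
  then show "a \<odot>\<^bsub>E\<^esub> x \<in> (\<lambda>r. r \<odot>\<^bsub>E\<^esub> v) ` A"
    using assms(4)[OF a r(1)] by blast
qed

lemma irreducible_generated:
  assumes "irreducible_module R E" "v \<in> carrier E" "v \<noteq> \<zero>\<^bsub>E\<^esub>"
  shows "(\<lambda>r. r \<odot>\<^bsub>E\<^esub> v) ` carrier R = carrier E"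
proof -
  have "v \<in> (\<lambda>r. r \<odot>\<^bsub>E\<^esub> v) ` carrier R"
    using assms(2) smult_one by force
  moreover have "submodule ((\<lambda>r. r \<odot>\<^bsub>E\<^esub> v) ` carrier R) R E"
    by (rule submodule_image) (use assms in auto)
  ultimately show ?thesis
    using assms by (auto simp: irreducible_module_def)
qed

end

text \<open>\<open>F\<close> and \<open>G\<close> are the quotients of the left ideal
  \<open>A\<close> by the annihilators in \<open>A\<close> of \<open>x\<close> and \<open>y\<close>.
  By \<open>ann\<close> the second annihilator is contained in the first; irreducibility of
  \<open>G\<close> and \<open>F\<close> being nonzero force equality, so
  \<open>r y \<mapsto> r x\<close> is well defined and bijective.\<close>

lemma irreducible_quotient_iso:
  assumes "left_module R F" "left_module R G"
    and irr: "irreducible_module R F" "irreducible_module R G"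
    and A: "A \<subseteq> carrier R" "\<zero>\<^bsub>R\<^esub> \<in> A"
      "\<And>r s. r \<in> A \<Longrightarrow> s \<in> A \<Longrightarrow> r \<oplus>\<^bsub>R\<^esub> s \<in> A"
      "\<And>r s. r \<in> carrier R \<Longrightarrow> s \<in> A \<Longrightarrow> r \<otimes>\<^bsub>R\<^esub> s \<in> A"
    and x: "x \<in> carrier F" and y: "y \<in> carrier G"
    and Ax: "(\<lambda>r. r \<odot>\<^bsub>F\<^esub> x) ` A = carrier F" and Ay: "(\<lambda>r. r \<odot>\<^bsub>G\<^esub> y) ` A = carrier G"
    and ann: "\<And>r. r \<in> A \<Longrightarrow> r \<odot>\<^bsub>G\<^esub> y = \<zero>\<^bsub>G\<^esub> \<Longrightarrow> r \<odot>\<^bsub>F\<^esub> x = \<zero>\<^bsub>F\<^esub>"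
  shows "module_isomorphic R G F"
proof -
  interpret F: left_module R F by fact
  interpret G: left_module R G by fact
  have diff: "r \<ominus>\<^bsub>R\<^esub> s \<in> A" if "r \<in> A" "s \<in> A" for r s
  proof -
    have "r \<ominus>\<^bsub>R\<^esub> s = r \<oplus>\<^bsub>R\<^esub> (\<ominus>\<^bsub>R\<^esub> \<one>\<^bsub>R\<^esub>) \<otimes>\<^bsub>R\<^esub> s"
      using that A(1) by (simp add: a_minus_def F.R.l_minus subset_iff)
    then show ?thesis
      using A(3)[OF that(1) A(4)[OF _ that(2)]] by simp
  qed
  have eq_F: "r \<odot>\<^bsub>F\<^esub> x = s \<odot>\<^bsub>F\<^esub> x" if "r \<in> A" "s \<in> A" "r \<odot>\<^bsub>G\<^esub> y = s \<odot>\<^bsub>G\<^esub> y" for r s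
    using that ann[OF diff[OF that(1,2)]] F.smult_eq_iff[OF _ _ x, of r s]
      G.smult_eq_iff[OF _ _ y, of r s] A(1) by blast
  have ann': "r \<odot>\<^bsub>G\<^esub> y = \<zero>\<^bsub>G\<^esub>" if r: "r \<in> A" "r \<odot>\<^bsub>F\<^esub> x = \<zero>\<^bsub>F\<^esub>" for r
  proof -
    define B where "B = {r \<in> A. r \<odot>\<^bsub>F\<^esub> x = \<zero>\<^bsub>F\<^esub>}"
    have "submodule ((\<lambda>r. r \<odot>\<^bsub>G\<^esub> y) ` B) R G"
    proof (rule G.submodule_image)
      show "r \<otimes>\<^bsub>R\<^esub> s \<in> B" if "r \<in> carrier R" "s \<in> B" for r s
        using that A x by (auto simp: B_def F.smult_assoc F.smult_r_null subset_iff)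
      show "r \<oplus>\<^bsub>R\<^esub> s \<in> B" if "r \<in> B" "s \<in> B" for r s
        using that A x by (auto simp: B_def F.smult_l_distr subset_iff)
    qed (use A x y in \<open>auto simp: B_def F.smult_l_null\<close>)
    then consider "(\<lambda>r. r \<odot>\<^bsub>G\<^esub> y) ` B = {\<zero>\<^bsub>G\<^esub>}" | "(\<lambda>r. r \<odot>\<^bsub>G\<^esub> y) ` B = carrier G"
      using irr(2) unfolding irreducible_module_def by blast
    then show ?thesis
    proof cases
      case 1
      then show ?thesis
        using r by (auto simp: B_def)
    next
      \<comment> \<open>Every element of \<open>A\<close> agrees on \<open>y\<close> with an element
        of \<open>B\<close>, hence also on \<open>x\<close>; so \<open>A\<close> annihilates
        \<open>x\<close>, and \<open>F\<close> would be zero.\<close>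
      case 2
      have "r \<odot>\<^bsub>F\<^esub> x = \<zero>\<^bsub>F\<^esub>" if "r \<in> A" for r
      proof -
        have "r \<odot>\<^bsub>G\<^esub> y \<in> (\<lambda>r. r \<odot>\<^bsub>G\<^esub> y) ` B"
          using that A(1) y 2 G.smult_closed by auto
        then show ?thesis
          using eq_F[OF that] by (auto simp: B_def)
      qed
      then have "carrier F \<subseteq> {\<zero>\<^bsub>F\<^esub>}"
        using Ax by auto
      then show ?thesis
        using irr(1) by (auto simp: irreducible_module_def)
    qed
  qed
  have eq_G: "r \<odot>\<^bsub>G\<^esub> y = s \<odot>\<^bsub>G\<^esub> y" if "r \<in> A" "s \<in> A" "r \<odot>\<^bsub>F\<^esub> x = s \<odot>\<^bsub>F\<^esub> x" for r s
    using that ann'[OF diff[OF that(1,2)]] F.smult_eq_iff[OF _ _ x, of r s]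
      G.smult_eq_iff[OF _ _ y, of r s] A(1) by blast
  \<comment> \<open>This is the map \<open>r y \<mapsto> r x\<close>; the choice of \<open>r\<close>
    is immaterial by \<open>eq_F\<close>.\<close>
  define f where "f z = (SOME r. r \<in> A \<and> z = r \<odot>\<^bsub>G\<^esub> y) \<odot>\<^bsub>F\<^esub> x" for z
  have f: "f (r \<odot>\<^bsub>G\<^esub> y) = r \<odot>\<^bsub>F\<^esub> x" if "r \<in> A" for r
  proof -
    define s where "s = (SOME s. s \<in> A \<and> r \<odot>\<^bsub>G\<^esub> y = s \<odot>\<^bsub>G\<^esub> y)"
    have "s \<in> A \<and> r \<odot>\<^bsub>G\<^esub> y = s \<odot>\<^bsub>G\<^esub> y"
      unfolding s_def by (rule someI[of _ r]) (simp add: that)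
    then have "s \<odot>\<^bsub>F\<^esub> x = r \<odot>\<^bsub>F\<^esub> x"
      using eq_F[of s r] that by simp
    then show ?thesis
      by (simp add: f_def s_def)
  qed
  have repr: "\<exists>r. r \<in> A \<and> r \<in> carrier R \<and> z = r \<odot>\<^bsub>G\<^esub> y" if "z \<in> carrier G" for z
    using that Ay A(1) by blast
  have "f \<in> hom (add_monoid G) (add_monoid F)"
  proof (rule homI)
    show "f z \<in> carrier (add_monoid F)" if "z \<in> carrier (add_monoid G)" for z
      using repr[of z] that f x F.smult_closed by force
    fix z z' assume "z \<in> carrier (add_monoid G)" "z' \<in> carrier (add_monoid G)"
    then obtain r s where rs: "r \<in> A" "s \<in> A" "r \<in> carrier R" "s \<in> carrier R"
        "z = r \<odot>\<^bsub>G\<^esub> y" "z' = s \<odot>\<^bsub>G\<^esub> y"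
      using repr[of z] repr[of z'] by auto
    then show "f (z \<otimes>\<^bsub>add_monoid G\<^esub> z') = f z \<otimes>\<^bsub>add_monoid F\<^esub> f z'"
      using f[OF A(3)[OF rs(1,2)]] f[OF rs(1)] f[OF rs(2)] x y
      by (simp add: G.smult_l_distr F.smult_l_distr)
  qed
  moreover have "bij_betw f (carrier G) (carrier F)"
  proof (rule bij_betw_imageI)
    show "inj_on f (carrier G)"
    proof (rule inj_onI)
      fix z z' assume "z \<in> carrier G" "z' \<in> carrier G" and eq: "f z = f z'"
      then obtain r s where rs: "r \<in> A" "s \<in> A" "z = r \<odot>\<^bsub>G\<^esub> y" "z' = s \<odot>\<^bsub>G\<^esub> y"
        using repr[of z] repr[of z'] by auto
      show "z = z'"
        using eq eq_G[OF rs(1,2)] unfolding rs(3,4) f[OF rs(1)] f[OF rs(2)] by simp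
    qed
    have "f ` carrier G = f ` (\<lambda>r. r \<odot>\<^bsub>G\<^esub> y) ` A"
      unfolding Ay ..
    also have "\<dots> = (\<lambda>r. r \<odot>\<^bsub>F\<^esub> x) ` A"
      unfolding image_image by (rule image_cong[OF refl f])
    finally show "f ` carrier G = carrier F"
      unfolding Ax .
  qed
  moreover have "f (r \<odot>\<^bsub>G\<^esub> z) = r \<odot>\<^bsub>F\<^esub> f z" if r: "r \<in> carrier R" and z: "z \<in> carrier G" for r z
  proof -
    obtain s where s: "s \<in> A" "s \<in> carrier R" "z = s \<odot>\<^bsub>G\<^esub> y"
      using repr[OF z] by blast
    then show ?thesis
      using f[OF A(4)[OF r s(1)]] f[OF s(1)] F.smult_assoc[OF r s(2) x] G.smult_assoc[OF r s(2) y]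
      by simp
  qed
  ultimately show ?thesis
    by (auto simp: module_isomorphic_def iso_def)
qed

text \<open>A form of the Chinese remainder theorem. In the induction step, if the elements
  annihilating every \<open>v E\<close> with \<open>E\<close> in \<open>insert G J\<close> did not
  move \<open>v F\<close> onto all of \<open>F\<close>, they would annihilate \<open>v F\<close>.
  The left ideal \<open>A\<close> belonging to \<open>J\<close> would then satisfy the hypotheses of
  \<open>irreducible_quotient_iso\<close>, making \<open>G\<close> and \<open>F\<close>
  isomorphic.\<close>

lemma nonisomorphic_irreducible_separation:
  fixes J :: "('r, 'm, 'q) module_scheme set"
  assumes "finite J" "F \<notin> J"
    and "\<And>E. E \<in> insert F J \<Longrightarrow> left_module R E"
    and "\<And>E. E \<in> insert F J \<Longrightarrow> irreducible_module R E"
    and "\<And>E. E \<in> insert F J \<Longrightarrow> v E \<in> carrier E \<and> v E \<noteq> \<zero>\<^bsub>E\<^esub>"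
    and "\<And>E E'. E \<in> insert F J \<Longrightarrow> E' \<in> insert F J \<Longrightarrow> E \<noteq> E' \<Longrightarrow> \<not> module_isomorphic R E E'"
  shows "(\<lambda>r. r \<odot>\<^bsub>F\<^esub> v F) ` {r \<in> carrier R. \<forall>E\<in>J. r \<odot>\<^bsub>E\<^esub> v E = \<zero>\<^bsub>E\<^esub>} = carrier F"
  using assms
proof (induction J arbitrary: F rule: finite_induct)
  case empty
  interpret F: left_module R F
    using empty by simp
  show ?case
    using F.irreducible_generated[of "v F"] empty by simp
next
  case (insert G J)
  define A where "A = {r \<in> carrier R. \<forall>E\<in>J. r \<odot>\<^bsub>E\<^esub> v E = \<zero>\<^bsub>E\<^esub>}"
  define B where "B = {r \<in> carrier R. \<forall>E\<in>insert G J. r \<odot>\<^bsub>E\<^esub> v E = \<zero>\<^bsub>E\<^esub>}"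
  interpret F: left_module R F
    using insert by simp
  have lm: "left_module R E" and vE: "v E \<in> carrier E" if "E \<in> insert F (insert G J)" for E
    using insert.prems that by auto
  have ann_zero: "\<zero>\<^bsub>R\<^esub> \<odot>\<^bsub>E\<^esub> v E = \<zero>\<^bsub>E\<^esub>" if "E \<in> insert G J" for E
    using left_module.smult_l_null[OF lm vE] that by simp
  have ann_add: "(r \<oplus>\<^bsub>R\<^esub> s) \<odot>\<^bsub>E\<^esub> v E = \<zero>\<^bsub>E\<^esub>"
    if "E \<in> insert G J" "r \<in> carrier R" "s \<in> carrier R" "r \<odot>\<^bsub>E\<^esub> v E = \<zero>\<^bsub>E\<^esub>" "s \<odot>\<^bsub>E\<^esub> v E = \<zero>\<^bsub>E\<^esub>" for E r s
  proof -
    interpret E: left_module R E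
      using lm that by simp
    show ?thesis
      using that vE[of E] by (simp add: E.smult_l_distr)
  qed
  have ann_mult: "(r \<otimes>\<^bsub>R\<^esub> s) \<odot>\<^bsub>E\<^esub> v E = \<zero>\<^bsub>E\<^esub>"
    if "E \<in> insert G J" "r \<in> carrier R" "s \<in> carrier R" "s \<odot>\<^bsub>E\<^esub> v E = \<zero>\<^bsub>E\<^esub>" for E r s
  proof -
    interpret E: left_module R E
      using lm that by simp
    show ?thesis
      using that vE[of E] by (simp add: E.smult_assoc E.smult_r_null)
  qed
  have "submodule ((\<lambda>r. r \<odot>\<^bsub>F\<^esub> v F) ` B) R F"
    by (rule F.submodule_image) (auto simp: B_def ann_zero ann_add ann_mult vE)
  then consider "(\<lambda>r. r \<odot>\<^bsub>F\<^esub> v F) ` B = carrier F" | "(\<lambda>r. r \<odot>\<^bsub>F\<^esub> v F) ` B = {\<zero>\<^bsub>F\<^esub>}"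
    using insert.prems(3)[of F] unfolding irreducible_module_def by blast
  then show ?case
  proof cases
    case 1
    then show ?thesis
      by (simp add: B_def)
  next
    case 2
    have AF: "(\<lambda>r. r \<odot>\<^bsub>F\<^esub> v F) ` A = carrier F"
      unfolding A_def by (rule insert.IH) (use insert.prems in auto)
    have AG: "(\<lambda>r. r \<odot>\<^bsub>G\<^esub> v G) ` A = carrier G"
      unfolding A_def by (rule insert.IH) (use insert.prems insert.hyps in auto)
    have "module_isomorphic R G F"
    proof (rule irreducible_quotient_iso[OF _ _ _ _ _ _ _ _ _ _ AF AG])
      show "r \<odot>\<^bsub>F\<^esub> v F = \<zero>\<^bsub>F\<^esub>" if "r \<in> A" "r \<odot>\<^bsub>G\<^esub> v G = \<zero>\<^bsub>G\<^esub>" for r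
      proof -
        have "r \<in> B"
          using that by (simp add: A_def B_def)
        then show ?thesis
          using 2 by blast
      qed
    qed (use insert.prems in \<open>auto simp: A_def ann_zero ann_add ann_mult\<close>)
    then show ?thesis
      using insert.prems(1) insert.prems(5)[of G F] by auto
  qed
qed

section \<open>Galois ring settings\<close>

lemma sum_fun_apply: "(\<Sum>a\<in>A. f a) i = (\<Sum>a\<in>A. f a i)"
  by (induction A rule: infinite_finite_induct) simp_all

section \<open>Automorphisms of a commutative algebra\<close>

context comm_k_algebra
begin

lemma alg_autD:
  assumes "f \<in> carrier (alg_aut scale)"
  shows "bij f" and "f (x + y) = f x + f y" and "f (x * y) = f x * f y" and "f 1 = 1"
    and "f 0 = 0" and "f (- x) = - f x" and "f (x - y) = f x - f y"
    and "f (scale c x) = scale c (f x)" and "f x = 0 \<longleftrightarrow> x = 0"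
proof -
  have lin: "Vector_Spaces.linear scale scale f" and b: "bij f"
    using assms by (auto simp: alg_aut_def)
  then interpret f: Vector_Spaces.linear scale scale f
    by simp
  show "bij f" "f (x + y) = f x + f y" "f 0 = 0" "f (- x) = - f x" "f (x - y) = f x - f y"
      "f (scale c x) = scale c (f x)"
    using b by (simp_all add: f.add f.neg f.diff f.scale)
  show "f (x * y) = f x * f y" "f 1 = 1"
    using assms by (auto simp: alg_aut_def)
  show "f x = 0 \<longleftrightarrow> x = 0"
    using b f.zero by (metis bij_is_inj injD)
qed

lemma alg_aut_prod: "f \<in> carrier (alg_aut scale) \<Longrightarrow> f (prod g A) = (\<Prod>a\<in>A. f (g a))"
  by (induction A rule: infinite_finite_induct) (simp_all add: alg_autD)

lemma alg_autI:
  assumes "bij f" "\<And>x y. f (x + y) = f x + f y" "\<And>c x. f (scale c x) = scale c (f x)"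
    "f 1 = 1" "\<And>x y. f (x * y) = f x * f y"
  shows "f \<in> carrier (alg_aut scale)"
  using assms vector_space_axioms by (simp add: alg_aut_def Vector_Spaces.linear_iff)

lemma comp_alg_aut:
  assumes "f \<in> carrier (alg_aut scale)" "g \<in> carrier (alg_aut scale)"
  shows "f \<circ> g \<in> carrier (alg_aut scale)"
  by (rule alg_autI) (simp_all add: alg_autD[OF assms(1)] alg_autD[OF assms(2)] bij_comp)

lemma inv_into_alg_aut:
  assumes f: "f \<in> carrier (alg_aut scale)"
  shows "inv_into UNIV f \<in> carrier (alg_aut scale)"
proof -
  note f_inv = surj_f_inv_f[OF bij_is_surj[OF alg_autD(1)[OF f]]]
  have eqI: "inv_into UNIV f x = y" if "x = f y" for x y
    using that by (simp add: bij_is_inj[OF alg_autD(1)[OF f]])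
  show ?thesis
  proof (rule alg_autI)
    show "bij (inv_into UNIV f)"
      using alg_autD(1)[OF f] by (rule bij_imp_bij_inv)
  qed (rule eqI; simp add: alg_autD[OF f] f_inv)+
qed

lemma id_alg_aut: "id \<in> carrier (alg_aut scale)"
  by (rule alg_autI) simp_all

lemma group_alg_aut: "group (alg_aut scale)"
proof (rule groupI)
  show "\<exists>g\<in>carrier (alg_aut scale). g \<otimes>\<^bsub>alg_aut scale\<^esub> f = \<one>\<^bsub>alg_aut scale\<^esub>"
    if f: "f \<in> carrier (alg_aut scale)" for f
  proof
    show "inv_into UNIV f \<otimes>\<^bsub>alg_aut scale\<^esub> f = \<one>\<^bsub>alg_aut scale\<^esub>"
      using bij_is_inj[OF alg_autD(1)[OF f]] by (simp add: alg_aut_def)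
  qed (rule inv_into_alg_aut[OF f])
  show "f \<otimes>\<^bsub>alg_aut scale\<^esub> g \<in> carrier (alg_aut scale)"
    if "f \<in> carrier (alg_aut scale)" "g \<in> carrier (alg_aut scale)" for f g
    using comp_alg_aut[OF that] by (simp add: alg_aut_def)
  show "\<one>\<^bsub>alg_aut scale\<^esub> \<in> carrier (alg_aut scale)"
    using id_alg_aut by (simp add: alg_aut_def)
qed (simp_all add: alg_aut_def comp_assoc)

lemma subgroup_alg_autD:
  assumes "subgroup H (alg_aut scale)"
  shows "H \<subseteq> carrier (alg_aut scale)" and "id \<in> H" and "f \<in> H \<Longrightarrow> g \<in> H \<Longrightarrow> f \<circ> g \<in> H"
    and "f \<in> H \<Longrightarrow> inv_into UNIV f \<in> H"
proof -
  interpret group "alg_aut scale"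
    by (rule group_alg_aut)
  show sub: "H \<subseteq> carrier (alg_aut scale)" and "id \<in> H" and "f \<in> H \<Longrightarrow> g \<in> H \<Longrightarrow> f \<circ> g \<in> H"
    using subgroup.subset[OF assms] subgroup.one_closed[OF assms] subgroup.m_closed[OF assms]
    by (auto simp: alg_aut_def)
  show "inv_into UNIV f \<in> H" if "f \<in> H"
  proof -
    have f: "f \<in> carrier (alg_aut scale)"
      using that sub by blast
    have "inv\<^bsub>alg_aut scale\<^esub> f = inv_into UNIV f"
      using bij_is_inj[OF alg_autD(1)[OF f]]
      by (intro inv_equality f inv_into_alg_aut) (simp add: alg_aut_def)
    then show ?thesis
      using subgroup.m_inv_closed[OF assms that] by simp
  qed
qed

end

text \<open>In the Galois descent below this bounds the size of sets that are linearly independent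
  over \<open>L\<close>.\<close>

lemma pointwise_support_subset_span:
  fixes S :: "'i set"
  assumes "finite S"
  shows "{x :: 'i \<Rightarrow> 'b::field. \<forall>i. i \<notin> S \<longrightarrow> x i = 0} \<subseteq>
    module.span (\<lambda>c x i. c * x i) ((\<lambda>s i. if i = s then 1 else 0) ` S)"
proof
  interpret pw: vector_space "\<lambda>c (x :: 'i \<Rightarrow> 'b) i. c * x i"
    by unfold_locales (simp_all add: fun_eq_iff algebra_simps)
  fix x :: "'i \<Rightarrow> 'b"
  assume "x \<in> {x. \<forall>i. i \<notin> S \<longrightarrow> x i = 0}"
  then have "x = (\<Sum>s\<in>S. (\<lambda>i. x s * (if i = s then 1 else 0)))"
    using assms by (auto simp: fun_eq_iff sum_fun_apply sum.delta' if_distrib cong: if_cong)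
  also have "\<dots> \<in> pw.span ((\<lambda>s i. if i = s then 1 else 0) ` S)"
    by (intro pw.span_sum pw.span_scale pw.span_base) simp
  finally show "x \<in> pw.span ((\<lambda>s i. if i = s then 1 else 0) ` S)" .
qed

text \<open>\<open>m_inv\<close> is a definite description over the carrier, so its value can be
  computed without assuming that the record is a group.\<close>

lemma additive_a_inv:
  fixes E :: "('b::ab_group_add, 'p) ring_scheme"
  assumes "add E = (+)" "ring.zero E = 0" "x \<in> carrier E" "- x \<in> carrier E"
  shows "inv\<^bsub>add_monoid E\<^esub> x = - x"
  unfolding m_inv_def using assms
  by (intro the_equality) (auto simp: add_eq_0_iff add.commute)

lemma additive_subgroupI:
  fixes E :: "('b::ab_group_add, 'p) ring_scheme"
  assumes "add E = (+)" "ring.zero E = 0" "H \<subseteq> carrier E" "0 \<in> H"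
    and "\<And>x y. x \<in> H \<Longrightarrow> y \<in> H \<Longrightarrow> x + y \<in> H" "\<And>x. x \<in> H \<Longrightarrow> - x \<in> H"
  shows "subgroup H (add_monoid E)"
proof (rule subgroup.intro)
  show "inv\<^bsub>add_monoid E\<^esub> x \<in> H" if "x \<in> H" for x
    using additive_a_inv[OF assms(1,2), of x] assms(3) assms(6)[OF that] that by (simp add: subset_iff)
qed (use assms in auto)

context galois_ring_setting
begin

lemmas W_alg_aut = subgroup_alg_autD[OF subgroup_W]

lemma W_D: "w \<in> W \<Longrightarrow> w \<in> carrier (alg_aut scale)"
  using W_alg_aut(1) by blast

lemma M_D: "\<mu> \<in> M \<Longrightarrow> \<mu> \<in> carrier (alg_aut scale)"
  using submonoid.subset[OF submonoid_M] by blast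

section \<open>Extension of automorphisms to the fraction field\<close>

lemma frac_map_aut:
  assumes "f \<in> carrier (alg_aut scale)" "b \<noteq> 0"
  shows "frac_map f (Fraction_Field.Fract a b) = Fraction_Field.Fract (f a) (f b)"
  by (rule frac_map_Fract) (simp_all add: alg_autD[OF assms(1)] bij_is_inj assms)

lemma frac_map_to_fract:
  "f \<in> carrier (alg_aut scale) \<Longrightarrow> frac_map f (to_fract a) = to_fract (f a)"
  by (simp add: to_fract_def frac_map_aut alg_autD)

lemma frac_map_hom:
  assumes f: "f \<in> carrier (alg_aut scale)"
  shows "frac_map f (q + r) = frac_map f q + frac_map f r"
    and "frac_map f (q * r) = frac_map f q * frac_map f r"
    and "frac_map f 0 = 0"
    and "frac_map f q = 0 \<longleftrightarrow> q = 0"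
proof -
  obtain a b c d where q: "q = Fraction_Field.Fract a b" "b \<noteq> 0"
    and r: "r = Fraction_Field.Fract c d" "d \<noteq> 0"
    by (metis Fract_cases)
  show "frac_map f (q + r) = frac_map f q + frac_map f r"
    and "frac_map f (q * r) = frac_map f q * frac_map f r"
    using q r by (simp_all add: frac_map_aut[OF f] alg_autD[OF f])
  show "frac_map f 0 = 0"
    using frac_map_to_fract[OF f, of 0] by (simp add: alg_autD[OF f])
  show "frac_map f q = 0 \<longleftrightarrow> q = 0"
    using q by (simp add: frac_map_aut[OF f] alg_autD[OF f] Zero_fract_def eq_fract)
qed

lemma frac_map_sum:
  "f \<in> carrier (alg_aut scale) \<Longrightarrow> frac_map f (sum g A) = (\<Sum>a\<in>A. frac_map f (g a))"
  by (induction A rule: infinite_finite_induct) (simp_all add: frac_map_hom)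

lemma frac_map_id: "frac_map id (q :: 'a fract) = q"
  by (cases q) (simp add: frac_map_aut[OF id_alg_aut])

lemma Gamma_closed:
  shows "0 \<in> Gamma W" "1 \<in> Gamma W" "a \<in> Gamma W \<Longrightarrow> b \<in> Gamma W \<Longrightarrow> a + b \<in> Gamma W"
    "a \<in> Gamma W \<Longrightarrow> b \<in> Gamma W \<Longrightarrow> a * b \<in> Gamma W" "a \<in> Gamma W \<Longrightarrow> - a \<in> Gamma W"
    "a \<in> Gamma W \<Longrightarrow> b \<in> Gamma W \<Longrightarrow> a - b \<in> Gamma W" "a \<in> Gamma W \<Longrightarrow> scale c a \<in> Gamma W"
  by (auto simp: Gamma_def alg_autD[OF W_D])

lemma GammaD: "a \<in> Gamma W \<Longrightarrow> w \<in> W \<Longrightarrow> w a = a"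
  by (simp add: Gamma_def)

section \<open>The norm and the fixed field of \<open>W\<close>\<close>

lemma W_bij_comp: "w \<in> W \<Longrightarrow> bij_betw ((\<circ>) w) W W"
proof (rule bij_betw_byWitness[where f' = "(\<circ>) (inv_into UNIV w)"])
  assume w: "w \<in> W"
  then have "bij w"
    using alg_autD(1)[OF W_D] by blast
  then show "\<forall>v\<in>W. inv_into UNIV w \<circ> (w \<circ> v) = v" "\<forall>v\<in>W. w \<circ> (inv_into UNIV w \<circ> v) = v"
    by (auto simp: fun_eq_iff bij_is_inj surj_f_inv_f bij_is_surj)
  show "(\<circ>) w ` W \<subseteq> W" "(\<circ>) (inv_into UNIV w) ` W \<subseteq> W"
    using W_alg_aut(3,4) w by auto
qed

text \<open>A multiple of \<open>a\<close> in \<Gamma> that is nonzero for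
  \<open>a \<noteq> 0\<close>: it makes denominators invariant in \<open>fixed_field\<close> and
  detects conjugates of elements of \<open>P\<close> in \<open>returningI\<close>.\<close>

definition galois_norm :: "'a \<Rightarrow> 'a" where
  "galois_norm a = (\<Prod>w\<in>W. w a)"

lemma galois_norm_Gamma: "galois_norm a \<in> Gamma W"
proof -
  have "v (galois_norm a) = galois_norm a" if v: "v \<in> W" for v
  proof -
    have "v (galois_norm a) = (\<Prod>w\<in>W. (v \<circ> w) a)"
      by (simp add: galois_norm_def alg_aut_prod[OF W_D[OF v]])
    also have "\<dots> = galois_norm a"
      unfolding galois_norm_def using W_bij_comp[OF v] by (rule prod.reindex_bij_betw)
    finally show ?thesis .
  qed
  then show ?thesis
    by (simp add: Gamma_def)
qed

lemma dvd_galois_norm: "a dvd galois_norm a"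
  unfolding galois_norm_def using dvd_prodI[OF finite_W W_alg_aut(2), of "\<lambda>w. w a"] by simp

lemma galois_norm_eq_0_iff: "galois_norm a = 0 \<longleftrightarrow> a = 0"
proof -
  have "galois_norm a = 0 \<longleftrightarrow> (\<exists>w\<in>W. w a = 0)"
    unfolding galois_norm_def by (rule prod_zero_iff[OF finite_W])
  then show ?thesis
    using alg_autD(9)[OF W_D] W_alg_aut(2) by blast
qed

text \<open>Expand the fraction so that its denominator becomes a norm. The denominator is then
  invariant, and invariance of the fraction makes the numerator invariant too.\<close>

lemma fixed_field:
  assumes "\<And>w. w \<in> W \<Longrightarrow> frac_map w q = q"
  shows "q \<in> carrier (K_ring W)"
proof -
  obtain a b where q: "q = Fraction_Field.Fract a b" "b \<noteq> 0"
    by (metis Fract_cases)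
  obtain c where c: "galois_norm b = b * c"
    using dvd_galois_norm by (rule dvdE)
  have nb: "galois_norm b \<noteq> 0"
    using q by (simp add: galois_norm_eq_0_iff)
  have q': "q = Fraction_Field.Fract (a * c) (galois_norm b)"
    using q nb by (simp add: eq_fract c)
  have "w (a * c) = a * c" if w: "w \<in> W" for w
  proof -
    have "Fraction_Field.Fract (w (a * c)) (galois_norm b) = Fraction_Field.Fract (a * c) (galois_norm b)"
      using assms[OF w] frac_map_aut[OF W_D[OF w] nb] GammaD[OF galois_norm_Gamma w]
      unfolding q' by simp
    then show ?thesis
      using nb by (simp add: eq_fract)
  qed
  then show ?thesis
    using q' nb galois_norm_Gamma[of b] by (auto simp: K_ring_def Gamma_def)
qed

section \<open>Arithmetic in the skew monoid ring and its invariants\<close>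

lemma coeff_emb_id: "coeff_emb l id = l"
  by (simp add: coeff_emb_def)

lemma skew_mult_coeff_left:
  assumes "finite (supp x)"
  shows "coeff_emb (l :: 'a fract) \<otimes>\<^bsub>skew_ring N\<^esub> x = (\<lambda>\<rho>. l * x \<rho>)"
\<comment> \<open>The product sums over supports, and the support of \<open>coeff_emb l\<close> is
  \<open>{id}\<close> only for \<open>l \<noteq> 0\<close>.\<close>
proof (cases "l = 0")
  case True
  then show ?thesis
    by (simp add: skew_ring_def supp_def coeff_emb_def)
next
  case False
  then have supp: "supp (coeff_emb l :: 'a skew) = {id}"
    by (auto simp: supp_def coeff_emb_def)
  then have "(coeff_emb l \<otimes>\<^bsub>skew_ring N\<^esub> x) \<rho> = (\<Sum>\<nu>\<in>supp x. if \<nu> = \<rho> then l * x \<nu> else 0)" for \<rho>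
    by (simp add: skew_ring_def, unfold supp) (simp add: frac_map_id coeff_emb_id cong: if_cong)
  then show ?thesis
    using assms by (intro ext) (simp add: sum.delta, simp add: supp_def)
qed

lemma skew_mult_coeff_right:
  assumes "finite (supp x)" "supp x \<subseteq> M"
  shows "x \<otimes>\<^bsub>skew_ring N\<^esub> coeff_emb l = (\<lambda>\<rho>. x \<rho> * frac_map \<rho> l)"
proof (cases "l = 0")
  case True
  \<comment> \<open>Outside \<open>M\<close> nothing is known about
    \<open>frac_map \<rho> 0\<close>, but there \<open>x \<rho>\<close> vanishes.\<close>
  have "x \<rho> * frac_map \<rho> 0 = 0" for \<rho>
    using assms(2) frac_map_hom(3)[OF M_D, of \<rho>] by (auto simp: supp_def)
  then show ?thesis
    using True by (simp add: skew_ring_def supp_def coeff_emb_def fun_eq_iff)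
next
  case False
  then have supp: "supp (coeff_emb l :: 'a skew) = {id}"
    by (auto simp: supp_def coeff_emb_def)
  then have "(x \<otimes>\<^bsub>skew_ring N\<^esub> coeff_emb l) \<rho> =
      (\<Sum>\<mu>\<in>supp x. if \<mu> = \<rho> then x \<mu> * frac_map \<mu> l else 0)" for \<rho>
    by (simp add: skew_ring_def, unfold supp) (simp add: coeff_emb_id cong: if_cong)
  then show ?thesis
    using assms by (intro ext) (simp add: sum.delta, simp add: supp_def)
qed

lemma KK_ring_simps [simp]:
  "monoid.mult (KK_ring M W) = monoid.mult (skew_ring M)"
  "add (KK_ring M W) = (+)" "ring.zero (KK_ring M W) = 0"
  "one (KK_ring M W) = coeff_emb 1"
  by (simp_all add: KK_ring_def skew_ring_def fun_eq_iff)

lemma KK_iff: "x \<in> carrier (KK_ring M W) \<longleftrightarrow>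
    finite (supp x) \<and> supp x \<subseteq> M \<and> (\<forall>w\<in>W. \<forall>\<rho>. frac_map w (x (inv_into UNIV w \<circ> \<rho> \<circ> w)) = x \<rho>)"
  by (auto simp: KK_ring_def skew_ring_def W_act_def fun_eq_iff)

lemma supp_add_subset: "supp (x + y) \<subseteq> supp x \<union> supp y"
  by (auto simp: supp_def)

lemma supp_uminus: "supp (- x) = supp x"
  by (auto simp: supp_def)

lemma K_fixed: "q \<in> carrier (K_ring W) \<Longrightarrow> w \<in> W \<Longrightarrow> frac_map w q = q"
  by (auto simp: K_ring_def frac_map_aut[OF W_D] GammaD)

lemma KK_add:
  assumes "x \<in> carrier (KK_ring M W)" "y \<in> carrier (KK_ring M W)"
  shows "x + y \<in> carrier (KK_ring M W)"
proof -
  have "finite (supp (x + y))" "supp (x + y) \<subseteq> M"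
    using assms supp_add_subset[of x y] unfolding KK_iff by (auto intro: finite_subset)
  then show ?thesis
    using assms by (simp add: KK_iff frac_map_hom[OF W_D])
qed

lemma KK_smult:
  assumes "q \<in> carrier (K_ring W)" "x \<in> carrier (KK_ring M W)"
  shows "(\<lambda>\<rho>. q * x \<rho>) \<in> carrier (KK_ring M W)"
proof -
  have "supp (\<lambda>\<rho>. q * x \<rho>) \<subseteq> supp x"
    by (auto simp: supp_def)
  then have "finite (supp (\<lambda>\<rho>. q * x \<rho>))" "supp (\<lambda>\<rho>. q * x \<rho>) \<subseteq> M"
    using assms unfolding KK_iff by (auto intro: finite_subset)
  then show ?thesis
    using assms K_fixed[OF assms(1)] by (simp add: KK_iff frac_map_hom[OF W_D])
qed

lemma KK_zero: "0 \<in> carrier (KK_ring M W)"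
  by (simp add: KK_iff supp_def frac_map_hom[OF W_D])

lemma minus_one_K: "- 1 \<in> carrier (K_ring W)"
proof -
  have "\<exists>a b. - 1 = Fraction_Field.Fract a b \<and> a \<in> Gamma W \<and> b \<in> Gamma W \<and> b \<noteq> 0"
    using Gamma_closed(2) Gamma_closed(5)[OF Gamma_closed(2)]
    by (intro exI[of _ "- 1 :: 'a"] exI[of _ "1 :: 'a"]) (simp add: One_fract_def)
  then show ?thesis
    by (simp add: K_ring_def)
qed

lemma KK_uminus: "x \<in> carrier (KK_ring M W) \<Longrightarrow> - x \<in> carrier (KK_ring M W)"
  using KK_smult[OF minus_one_K, of x] by (simp add: fun_Compl_def)

lemma left_KK_simps [simp]:
  "carrier (left_KK M W h) = carrier (KK_ring M W)" "add (left_KK M W h) = (+)"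
  "ring.zero (left_KK M W h) = 0"
  "r \<odot>\<^bsub>left_KK M W h\<^esub> x = h r \<otimes>\<^bsub>skew_ring M\<^esub> x"
  by (simp_all add: left_KK_def with_scalars_def)

lemma right_KK_simps [simp]:
  "carrier (right_KK M W h) = carrier (KK_ring M W)" "add (right_KK M W h) = (+)"
  "ring.zero (right_KK M W h) = 0"
  "r \<odot>\<^bsub>right_KK M W h\<^esub> x = x \<otimes>\<^bsub>skew_ring M\<^esub> h r"
  by (simp_all add: right_KK_def with_scalars_def)

text \<open>Galois descent: a subset of \<open>V\<close> that is maximal linearly independent over \<open>L\<close> spans \<open>V\<close>
  over \<open>K\<close>, since the coordinates of a \<open>W\<close>-invariant vector are \<open>W\<close>-invariant.\<close>

lemma fin_gen_bounded_support:
  assumes "finite S"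
  defines "V \<equiv> {x \<in> carrier (KK_ring M W). supp x \<subseteq> S}"
  shows "submodule V (K_ring W) (left_KK M W coeff_emb)"
    and "fin_gen (K_ring W) (left_KK M W coeff_emb) V"
proof -
  have smult: "q \<odot>\<^bsub>left_KK M W coeff_emb\<^esub> x = (\<lambda>\<rho>. q * x \<rho>)" if "x \<in> carrier (KK_ring M W)" for q x
    using that by (simp add: skew_mult_coeff_left KK_iff)
  show subV: "submodule V (K_ring W) (left_KK M W coeff_emb)"
  proof (intro submodule.intro submodule_axioms.intro additive_subgroupI)
    show "x + y \<in> V" if "x \<in> V" "y \<in> V" for x y
      using that KK_add[of x y] supp_add_subset[of x y] by (auto simp: V_def)
    show "- x \<in> V" if "x \<in> V" for x
      using that KK_uminus[of x] by (auto simp: V_def supp_uminus)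
    show "q \<odot>\<^bsub>left_KK M W coeff_emb\<^esub> x \<in> V" if q: "q \<in> carrier (K_ring W)" and x: "x \<in> V" for q x
    proof -
      have "supp (\<lambda>\<rho>. q * x \<rho>) \<subseteq> S"
        using x by (auto simp: V_def supp_def)
      then show ?thesis
        using KK_smult[OF q, of x] x smult[of x q] by (simp add: V_def)
    qed
  qed (auto simp: V_def KK_zero supp_def)
  interpret L: vector_space "\<lambda>c (x :: 'a skew) i. c * x i"
    by unfold_locales (simp_all add: fun_eq_iff algebra_simps)
  obtain B where B: "B \<subseteq> V" "L.independent B" "V \<subseteq> L.span B"
    by (rule L.maximal_independent_subset)
  have "V \<subseteq> L.span ((\<lambda>s i. if i = s then 1 else 0) ` S)"
    using pointwise_support_subset_span[OF assms(1)] by (fastforce simp: V_def supp_def)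
  then have "B \<subseteq> L.span ((\<lambda>s i. if i = s then 1 else 0) ` S)"
    using B(1) by simp
  then have fB: "finite B"
    using L.independent_span_bound[OF finite_imageI[OF assms(1)] B(2)] by simp
  have "V = mod_span (K_ring W) (left_KK M W coeff_emb) B"
  proof
    show "mod_span (K_ring W) (left_KK M W coeff_emb) B \<subseteq> V"
      using subV B(1) by (auto simp: mod_span_def)
    show "V \<subseteq> mod_span (K_ring W) (left_KK M W coeff_emb) B"
    proof
      fix x assume x: "x \<in> V"
      then obtain u where u: "x = (\<Sum>b\<in>B. (\<lambda>i. u b * b i))"
        using B(3) L.span_finite[OF fB] by blast
      have uK: "u b \<in> carrier (K_ring W)" if b: "b \<in> B" for b
      proof (rule fixed_field)
        fix w assume w: "w \<in> W"
        \<comment> \<open>Both \<open>x\<close> and the members of \<open>B\<close> are fixed by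
          \<open>w\<close>, so applying \<open>w\<close> to the expansion of \<open>x\<close>
          changes only the coefficients.\<close>
        have "x \<rho> = (\<Sum>b\<in>B. frac_map w (u b) * b \<rho>)" for \<rho>
        proof -
          have "x \<rho> = frac_map w (x (inv_into UNIV w \<circ> \<rho> \<circ> w))"
            using x w by (simp add: V_def KK_iff)
          also have "\<dots> = (\<Sum>b\<in>B. frac_map w (u b) * frac_map w (b (inv_into UNIV w \<circ> \<rho> \<circ> w)))"
            unfolding u by (simp add: frac_map_sum[OF W_D[OF w]] frac_map_hom[OF W_D[OF w]] sum_fun_apply)
          also have "\<dots> = (\<Sum>b\<in>B. frac_map w (u b) * b \<rho>)"
            using B(1) w by (intro sum.cong) (auto simp: V_def KK_iff)
          finally show ?thesis .
        qed
        then have "(\<Sum>b\<in>B. (\<lambda>i. (frac_map w (u b) - u b) * b i)) = 0"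
          by (simp add: u fun_eq_iff algebra_simps sum_subtractf sum_fun_apply)
        then have "frac_map w (u b) - u b = 0"
          using L.independentD[OF B(2) fB subset_refl, of "\<lambda>b. frac_map w (u b) - u b"] b by blast
        then show "frac_map w (u b) = u b"
          by simp
      qed
      have "x \<in> N" if N: "submodule N (K_ring W) (left_KK M W coeff_emb)" "B \<subseteq> N" for N
      proof -
        interpret N: submodule N "K_ring W" "left_KK M W coeff_emb"
          by (rule N)
        have "(\<Sum>b\<in>C. (\<lambda>i. u b * b i)) \<in> N" if "finite C" "C \<subseteq> B" for C
          using that
        proof (induction C rule: finite_induct)
          case empty
          then show ?case
            using N.one_closed by (simp add: zero_fun_def)
        next
          case (insert b C)
          have b: "b \<in> B" "b \<in> N" "b \<in> carrier (KK_ring M W)"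
            using insert B(1) N(2) by (auto simp: V_def)
          have "(\<lambda>i. u b * b i) \<in> N"
            using N.smult_closed[OF uK[OF b(1)] b(2)] unfolding smult[OF b(3)] .
          then show ?case
            using insert N.m_closed[of "\<lambda>i. u b * b i" "\<Sum>b\<in>C. (\<lambda>i. u b * b i)"]
            by (simp add: plus_fun_def)
        qed
        then show ?thesis
          using u fB by blast
      qed
      then show "x \<in> mod_span (K_ring W) (left_KK M W coeff_emb) B"
        by (auto simp: mod_span_def)
    qed
  qed
  then show "fin_gen (K_ring W) (left_KK M W coeff_emb) V"
    unfolding fin_gen_def using fB B(1) by (intro exI[of _ B]) (auto simp: V_def)
qed

end

section \<open>Galois orders at a maximal ideal\<close>

text \<open>Used for two coefficient maps: automorphisms of \<Lambda>, and the structure map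
  \<open>\<lambda>c. scale c 1\<close> of the base field.\<close>

lemma map_poly_hom:
  fixes f :: "'b::comm_semiring_0 \<Rightarrow> 'c::comm_semiring_0"
  assumes "f 0 = 0" "\<And>x y. f (x + y) = f x + f y"
  shows "map_poly f (p + q) = map_poly f p + map_poly f q"
    and "(\<And>x y. f (x * y) = f x * f y) \<Longrightarrow> map_poly f (p * q) = map_poly f p * map_poly f q"
proof -
  have sum: "f (sum g A) = (\<Sum>a\<in>A. f (g a))" for g and A :: "nat set"
    by (induction A rule: infinite_finite_induct) (simp_all add: assms)
  show "map_poly f (p + q) = map_poly f p + map_poly f q"
    by (rule poly_eqI) (simp add: coeff_map_poly assms)
  show "map_poly f (p * q) = map_poly f p * map_poly f q" if "\<And>x y. f (x * y) = f x * f y"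
    by (rule poly_eqI) (simp add: coeff_map_poly assms that coeff_mult sum)
qed

text \<open>Translates the record operations into those of the type. The carrier \<open>C\<close> is
  \<Gamma> for the ideal \<open>m\<close> and the whole type for \<open>P\<close>.\<close>

lemma ideal_of_typeD:
  fixes C :: "'b::comm_ring_1 set"
  assumes "ideal I (ring_of_type_algebra\<lparr>carrier := C\<rparr>)"
  shows "I \<subseteq> C" "0 \<in> I" "x \<in> I \<Longrightarrow> y \<in> I \<Longrightarrow> x + y \<in> I" "x \<in> I \<Longrightarrow> - x \<in> I"
    "x \<in> I \<Longrightarrow> c \<in> C \<Longrightarrow> c * x \<in> I" "1 \<in> C" "x \<in> C \<Longrightarrow> y \<in> C \<Longrightarrow> x * y \<in> C"
proof -
  let ?R = "ring_of_type_algebra\<lparr>carrier := C\<rparr>"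
  interpret ideal I ?R
    by fact
  have simps: "carrier ?R = C" "add ?R = (+)" "monoid.mult ?R = (*)" "ring.zero ?R = 0" "one ?R = 1"
    by (simp_all add: ring_of_type_algebra_def)
  show "I \<subseteq> C" "0 \<in> I" "x \<in> I \<Longrightarrow> y \<in> I \<Longrightarrow> x + y \<in> I" "x \<in> I \<Longrightarrow> c \<in> C \<Longrightarrow> c * x \<in> I" "1 \<in> C"
    "x \<in> C \<Longrightarrow> y \<in> C \<Longrightarrow> x * y \<in> C"
    using a_subset zero_closed a_closed[of x y] I_l_closed[of x c] one_closed m_closed[of x y]
      additive_subgroup.zero_closed[OF is_additive_subgroup]
      additive_subgroup.a_closed[OF is_additive_subgroup, of x y]
    unfolding simps by auto
  show "- x \<in> I" if "x \<in> I"
  proof -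
    \<comment> \<open>The negative of 1 in the record is identified with \<open>- 1\<close>; after
      that \<open>- x\<close> is a multiple of \<open>x\<close>.\<close>
    have "1 + \<ominus>\<^bsub>?R\<^esub> 1 = 0" "\<ominus>\<^bsub>?R\<^esub> 1 \<in> C"
      using r_neg[OF one_closed] a_inv_closed[OF one_closed] by (simp_all only: simps)
    moreover from this(1) have "\<ominus>\<^bsub>?R\<^esub> 1 = - 1"
      by (simp add: add_eq_0_iff)
    ultimately show ?thesis
      using I_l_closed[OF that, of "- 1"] by (simp add: simps)
  qed
qed

text \<open>The ideal \<open>J\<close> generated by \<open>I\<close> and \<open>x\<close> is
  strictly larger than \<open>I\<close>, hence contains 1.\<close>

lemma maximalideal_of_type_inverse:
  fixes C :: "'b::comm_ring_1 set"
  assumes max: "maximalideal I (ring_of_type_algebra\<lparr>carrier := C\<rparr>)" and x: "x \<in> C" "x \<notin> I"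
  shows "\<exists>y\<in>C. 1 - y * x \<in> I"
proof -
  let ?R = "ring_of_type_algebra\<lparr>carrier := C\<rparr>"
  interpret maximalideal I ?R
    by fact
  have simps: "carrier ?R = C" "add ?R = (+)" "monoid.mult ?R = (*)" "ring.zero ?R = 0" "one ?R = 1"
    by (simp_all add: ring_of_type_algebra_def)
  have carr: "ideal C ?R"
    using oneideal by (simp add: simps)
  note I = ideal_of_typeD[OF ideal_axioms] and C = ideal_of_typeD[OF carr]
  define J where "J = {a + y * x | a y. a \<in> I \<and> y \<in> C}"
  have "ideal J ?R"
  proof (rule idealI)
    show "ring ?R"
      by (rule ring_axioms)
    have mult: "c * z \<in> J" if "c \<in> C" "z \<in> J" for c z
    proof -
      obtain a y where ay: "a \<in> I" "y \<in> C" "z = a + y * x"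
        using \<open>z \<in> J\<close> by (auto simp: J_def)
      have "c * z = c * a + (c * y) * x"
        by (simp add: ay algebra_simps)
      moreover have "c * a \<in> I" "c * y \<in> C"
        using ay \<open>c \<in> C\<close> I(5) C(7) by auto
      ultimately show ?thesis
        by (auto simp: J_def)
    qed
    show "subgroup J (add_monoid ?R)"
    proof (rule additive_subgroupI)
      show "J \<subseteq> carrier ?R"
        using I(1) C x by (auto simp: simps J_def)
      show "0 \<in> J"
        using I(2) C(2) by (force simp: J_def)
      show "z + z' \<in> J" if z: "z \<in> J" "z' \<in> J" for z z'
      proof -
        obtain a y b y' where "a \<in> I" "y \<in> C" "z = a + y * x" "b \<in> I" "y' \<in> C" "z' = b + y' * x"
          using z unfolding J_def by blast
        then have "z + z' = (a + b) + (y + y') * x" "a + b \<in> I" "y + y' \<in> C"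
          using I(3) C(3) by (auto simp: algebra_simps)
        then show ?thesis
          by (auto simp: J_def)
      qed
      show "- z \<in> J" if "z \<in> J" for z
        using mult[of "- 1" z] that C(4,6) by simp
    qed (simp_all add: simps)
    show "z \<otimes>\<^bsub>?R\<^esub> a \<in> J" "a \<otimes>\<^bsub>?R\<^esub> z \<in> J" if "a \<in> J" "z \<in> carrier ?R" for a z
      using mult[of z a] that by (simp_all add: simps mult.commute)
  qed
  moreover have "I \<subseteq> J"
  proof
    fix a assume "a \<in> I"
    then have "a = a + 0 * x \<and> a \<in> I \<and> 0 \<in> C"
      using C(2) by simp
    then show "a \<in> J"
      unfolding J_def by blast
  qed
  moreover have "J \<subseteq> C"
    using I(1) C x by (auto simp: J_def)
  ultimately have "J = I \<or> J = C"
    using I_maximal[of J] by (simp add: simps)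
  moreover have "x \<in> J"
  proof -
    have "x = 0 + 1 * x \<and> 0 \<in> I \<and> 1 \<in> C"
      using C(6) I(2) by simp
    then show ?thesis
      unfolding J_def by blast
  qed
  ultimately have "1 \<in> J"
    using x(2) C(6) by auto
  then obtain a y where ay: "a \<in> I" "y \<in> C" "1 = a + y * x"
    unfolding J_def by blast
  then have "1 - y * x = a"
    by (metis add_diff_cancel_right')
  then show ?thesis
    using ay by blast
qed

section \<open>The maximal ideals \<open>m\<close> and \<open>P\<close>\<close>

locale galois_order_at = galois_ring_setting scale M W
  for scale :: "'k::alg_closed_field \<Rightarrow> 'a::idom \<Rightarrow> 'a" and M W +
  fixes U :: "'a skew set" and m P :: "'a set"
  assumes subgroup_M: "subgroup M (alg_aut scale)"
    and galois_order: "galois_order scale M W U"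
    and maximal_m: "maximalideal m (Gamma_ring W)"
    and maximal_P: "maximalideal P (ring_of_type_algebra :: 'a ring)"
    and lies_over: "P \<inter> Gamma W = m"
    and finite_stabilizer: "finite (stabilizer_in M P)"
begin

lemma m_ideal: "ideal m (ring_of_type_algebra\<lparr>carrier := Gamma W\<rparr>)"
  using maximalideal.axioms(1)[OF maximal_m] by (simp add: Gamma_ring_def)

lemmas m_D = ideal_of_typeD[OF m_ideal]

lemma maximal_P': "maximalideal P (ring_of_type_algebra\<lparr>carrier := UNIV\<rparr> :: 'a ring)"
  using maximal_P by (simp add: ring_of_type_algebra_def)

lemmas P_D = ideal_of_typeD[OF maximalideal.axioms(1)[OF maximal_P'], simplified]

lemma P_mult: "x \<in> P \<Longrightarrow> x * y \<in> P"
  using P_D(5)[of x y] by (simp add: mult.commute)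

lemma one_notin_P: "1 \<notin> P"
proof
  assume "1 \<in> P"
  then have "P = UNIV"
    using P_mult[of 1] by auto
  then show False
    using maximalideal.I_notcarr[OF maximal_P'] by simp
qed

lemma P_add_cancel: "x \<in> P \<Longrightarrow> x + y \<in> P \<Longrightarrow> y \<in> P"
  using P_D(3)[of "x + y" "- x"] P_D(4)[of x] by simp

lemma one_notin_m: "1 \<notin> m"
  using one_notin_P lies_over by blast

lemma P_inverse: "x \<notin> P \<Longrightarrow> \<exists>y. 1 - y * x \<in> P"
  using maximalideal_of_type_inverse[OF maximal_P', of x] by auto

lemma m_inverse: "x \<in> Gamma W \<Longrightarrow> x \<notin> m \<Longrightarrow> \<exists>y\<in>Gamma W. 1 - y * x \<in> m"
  using maximalideal_of_type_inverse[of m "Gamma W" x] maximal_m by (auto simp: Gamma_ring_def)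

lemma P_prime:
  assumes "x * y \<in> P"
  shows "x \<in> P \<or> y \<in> P"
proof (rule disjCI)
  assume "y \<notin> P"
  then obtain z where "1 - z * y \<in> P"
    using P_inverse by blast
  then have "x * (1 - z * y) + z * (x * y) \<in> P"
    using assms P_D(3,5) by auto
  then show "x \<in> P"
    by (simp add: algebra_simps)
qed

lemma m_prime:
  assumes "x * y \<in> m" "x \<in> Gamma W" "y \<in> Gamma W"
  shows "x \<in> m \<or> y \<in> m"
  using P_prime[of x y] assms lies_over by blast

lemma prod_in_P:
  assumes "finite A"
  shows "prod f A \<in> P \<longleftrightarrow> (\<exists>a\<in>A. f a \<in> P)"
  using assms
proof (induction A rule: finite_induct)
  case (insert a A)
  then show ?case
    using P_prime[of "f a" "prod f A"] P_mult[of "f a" "prod f A"] P_D(5)[of "prod f A" "f a"] by auto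
qed (simp add: one_notin_P)

section \<open>Elements of \<open>M\<close> that relate primes over \<open>m\<close>, and prime
  avoidance\<close>

lemmas M_alg_aut = subgroup_alg_autD[OF subgroup_M]

text \<open>As \<open>f\<close> maps \<open>P\<close> into itself, it carries an inverse of
  \<open>x\<close> modulo \<open>P\<close> to an inverse of \<open>f x\<close> modulo
  \<open>P\<close>; so \<open>f x\<close> lies in \<open>P\<close> only if \<open>x\<close>
  does.\<close>

lemma aut_image_P:
  assumes f: "f \<in> carrier (alg_aut scale)" and sub: "\<And>x. x \<in> P \<Longrightarrow> f x \<in> P"
  shows "f ` P = P"
proof
  show "f ` P \<subseteq> P"
    using sub by blast
  show "P \<subseteq> f ` P"
  proof
    fix y assume y: "y \<in> P"
    obtain x where x: "y = f x"
      using bij_is_surj[OF alg_autD(1)[OF f]] by (metis surjD)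
    have "x \<in> P"
    proof (rule ccontr)
      assume "x \<notin> P"
      then obtain z where z: "1 - z * x \<in> P"
        using P_inverse by blast
      have "f (1 - z * x) \<in> P"
        by (rule sub[OF z])
      then have "1 - f z * y \<in> P"
        by (simp add: alg_autD[OF f] x)
      then have "f z * y + (1 - f z * y) \<in> P"
        by (rule P_D(3)[OF P_D(5)[OF y]])
      then show False
        using one_notin_P by simp
    qed
    then show "y \<in> f ` P"
      using x by blast
  qed
qed

text \<open>The set \<open>S\<^sub>0\<close> of the introduction.\<close>

definition returning :: "('a \<Rightarrow> 'a) set" where
  "returning = {s \<in> M. \<exists>w\<in>W. \<exists>w'\<in>W. s ` w' ` P = w ` P}"

lemma M_conj: "w \<in> W \<Longrightarrow> s \<in> M \<Longrightarrow> w \<circ> s \<circ> inv_into UNIV w \<in> M"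
  using conj_M by blast

lemma inv_into_comp_aut:
  assumes "f \<in> carrier (alg_aut scale)"
  shows "inv_into UNIV f (f x) = x" "f (inv_into UNIV f x) = x"
  using alg_autD(1)[OF assms] by (simp_all add: bij_is_inj surj_f_inv_f bij_is_surj)

lemma inv_into_inv_into_aut:
  assumes "f \<in> carrier (alg_aut scale)"
  shows "inv_into UNIV (inv_into UNIV f) = f"
  using alg_autD(1)[OF assms] by (rule inv_inv_eq)

text \<open>Conjugation by \<open>w\<close> carries the witnessing primes \<open>v' P\<close> and
  \<open>v P\<close> to \<open>w v' P\<close> and \<open>w v P\<close>. This makes the part of a
  support outside \<open>returning\<close> stable under conjugation.\<close>

lemma returning_conj:
  assumes "w \<in> W" "s \<in> returning"
  shows "w \<circ> s \<circ> inv_into UNIV w \<in> returning"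
proof -
  obtain v v' where v: "v \<in> W" "v' \<in> W" "s ` v' ` P = v ` P" and s: "s \<in> M"
    using assms(2) by (auto simp: returning_def)
  have "(w \<circ> s \<circ> inv_into UNIV w) ` (w \<circ> v') ` P = w ` s ` v' ` P"
    by (simp add: image_image inv_into_comp_aut[OF W_D[OF assms(1)]])
  also have "\<dots> = (w \<circ> v) ` P"
    unfolding v(3) by (rule image_comp)
  finally show ?thesis
    using M_conj[OF assms(1) s] W_alg_aut(3)[OF assms(1) v(1)] W_alg_aut(3)[OF assms(1) v(2)]
    unfolding returning_def by blast
qed

text \<open>There are finitely many pairs \<open>w\<close>, \<open>w'\<close>. For each pair a fixed
  solution \<open>s1\<close> embeds the set of solutions \<open>s\<close> into the stabilizer of
  \<open>P\<close>, by sending \<open>s\<close> to the conjugate of \<open>s1\<inverse> s\<close> by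
  \<open>w'\<inverse>\<close>; this uses that \<open>M\<close> is a group stable under conjugation
  by \<open>W\<close>.\<close>

lemma finite_returning: "finite returning"
proof -
  have "finite {s \<in> M. s ` w' ` P = w ` P}" (is "finite ?D") if w: "w \<in> W" "w' \<in> W" for w w'
  proof (cases "?D = {}")
    case False
    then obtain s1 where s1: "s1 \<in> M" "s1 ` w' ` P = w ` P"
      by blast
    let ?w = "inv_into UNIV w'" and ?s = "inv_into UNIV s1"
    note w_inv = inv_into_comp_aut[OF W_D[OF w(2)]] and s_inv = inv_into_comp_aut[OF M_D[OF s1(1)]]
    define \<phi> where "\<phi> s = ?w \<circ> (?s \<circ> s) \<circ> w'" for s
    have "\<phi> ` ?D \<subseteq> stabilizer_in M P"
    proof clarify
      fix s assume s: "s \<in> M" "s ` w' ` P = w ` P"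
      have "?w \<circ> (?s \<circ> s) \<circ> inv_into UNIV ?w \<in> M"
        using M_conj[of ?w "?s \<circ> s"] W_alg_aut(4)[OF w(2)] M_alg_aut(3,4) s1(1) s(1) by auto
      then have "\<phi> s \<in> M"
        by (simp add: \<phi>_def inv_into_inv_into_aut[OF W_D[OF w(2)]])
      have "\<phi> s ` P = ?w ` ?s ` s ` w' ` P"
        by (simp add: \<phi>_def image_image)
      also have "\<dots> = ?w ` ?s ` s1 ` w' ` P"
        by (simp only: s(2) s1(2))
      also have "\<dots> = P"
        by (simp add: image_image w_inv s_inv)
      finally show "\<phi> s \<in> stabilizer_in M P"
        using \<open>\<phi> s \<in> M\<close> by (simp add: stabilizer_in_def)
    qed
    moreover have "inj_on \<phi> ?D"
    proof (rule inj_onI)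
      fix s t assume eq: "\<phi> s = \<phi> t"
      have recover: "u x = s1 (w' (\<phi> u (?w x)))" for u x
        by (simp add: \<phi>_def w_inv s_inv)
      show "s = t"
        by (rule ext) (simp only: recover[of s] recover[of t] eq)
    qed
    ultimately show ?thesis
      using finite_stabilizer by (metis (no_types, lifting) finite_imageD finite_subset)
  qed (simp only: finite.emptyI)
  then have "finite (\<Union>w\<in>W. \<Union>w'\<in>W. {s \<in> M. s ` w' ` P = w ` P})"
    using finite_W by auto
  then show ?thesis
    by (rule rev_finite_subset) (auto simp: returning_def)
qed

text \<open>Preimages of \<open>P\<close> under automorphisms are prime ideals. The lemma is applied
  with \<open>I\<close> equal to \<open>P\<close> and to \<open>m\<close>.\<close>

lemma prime_avoidance_preimages:
  assumes "finite F" "F \<subseteq> carrier (alg_aut scale)" "I \<noteq> {}"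
    and cover: "\<And>x. x \<in> I \<Longrightarrow> \<exists>f\<in>F. f x \<in> P"
    and I: "\<And>x y. x \<in> I \<Longrightarrow> y \<in> I \<Longrightarrow> x + y \<in> I" "\<And>x y. x \<in> I \<Longrightarrow> y \<in> I \<Longrightarrow> x * y \<in> I"
  shows "\<exists>f\<in>F. \<forall>x\<in>I. f x \<in> P"
proof -
  define A where "A = (\<lambda>f. {x. f x \<in> P}) ` F"
  have "\<exists>Q\<in>A. I \<subseteq> Q"
  proof (rule prime_avoidance)
    show "I \<subseteq> \<Union>A"
      using cover by (auto simp: A_def)
    show "finite A"
      by (simp add: A_def assms(1))
    have preimage: "\<exists>f\<in>carrier (alg_aut scale). Q = {x. f x \<in> P}" if "Q \<in> A" for Q
      using that assms(2) by (auto simp: A_def)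
    show "y \<in> Q" if Q: "Q \<in> A" "x \<in> Q" "x + y \<in> Q" for Q x y
    proof -
      obtain f where "f \<in> carrier (alg_aut scale)" "Q = {x. f x \<in> P}"
        using preimage[OF Q(1)] by blast
      then show ?thesis
        using Q(2,3) P_add_cancel[of "f x" "f y"] by (simp add: alg_autD(2))
    qed
    show "x * y \<in> Q" if Q: "Q \<in> A" "x \<in> Q" for Q x y
    proof -
      obtain f where "f \<in> carrier (alg_aut scale)" "Q = {x. f x \<in> P}"
        using preimage[OF Q(1)] by blast
      then show ?thesis
        using Q(2) P_mult[of "f x" "f y"] by (simp add: alg_autD(3))
    qed
    show "x \<in> Q \<or> y \<in> Q" if Q: "Q \<in> A" "x * y \<in> Q" for Q x y
    proof -
      obtain f where "f \<in> carrier (alg_aut scale)" "Q = {x. f x \<in> P}"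
        using preimage[OF Q(1)] by blast
      then show ?thesis
        using Q(2) P_prime[of "f x" "f y"] by (simp add: alg_autD(3))
    qed
  qed (fact assms(3) I)+
  then show ?thesis
    by (auto simp: A_def)
qed

text \<open>\<open>W\<close> is transitive on the primes over \<open>m\<close>: if \<open>s\<^sup>-\<^sup>1(P)\<close> contracts to \<open>m\<close> then, for \<open>x \<in> P\<close>,
  it contains the norm of \<open>x\<close>, hence a conjugate of \<open>x\<close>.\<close>

lemma returningI:
  assumes s: "s \<in> M" and sub: "\<And>a. a \<in> m \<Longrightarrow> s a \<in> P"
  shows "s \<in> returning"
proof -
  \<comment> \<open>The norm gives a suitable \<open>w\<close> for each \<open>x\<close> in
    \<open>P\<close>; prime avoidance makes the choice uniform in \<open>x\<close>.\<close>
  have "\<exists>f\<in>(\<lambda>w. s \<circ> w) ` W. \<forall>x\<in>P. f x \<in> P"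
  proof (rule prime_avoidance_preimages)
    show "(\<lambda>w. s \<circ> w) ` W \<subseteq> carrier (alg_aut scale)"
      using comp_alg_aut[OF M_D[OF s] W_D] by blast
    show "\<exists>f\<in>(\<lambda>w. s \<circ> w) ` W. f x \<in> P" if x: "x \<in> P" for x
    proof -
      have "galois_norm x \<in> m"
        using x galois_norm_Gamma dvd_galois_norm[of x] P_mult lies_over by (auto elim!: dvdE)
      then have "(\<Prod>w\<in>W. s (w x)) \<in> P"
        using sub by (simp add: galois_norm_def flip: alg_aut_prod[OF M_D[OF s]])
      then show ?thesis
        by (auto simp: prod_in_P[OF finite_W])
    qed
    show "P \<noteq> {}"
      using P_D(2) by blast
  qed (simp_all add: finite_W P_D(3) P_mult)
  then obtain w where w: "w \<in> W" "\<And>x. x \<in> P \<Longrightarrow> (s \<circ> w) x \<in> P"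
    by auto
  have "(s \<circ> w) ` P = P"
    using comp_alg_aut[OF M_D[OF s] W_D[OF w(1)]] w(2) by (rule aut_image_P)
  then have "s ` w ` P = id ` P"
    by (simp only: image_comp image_id id_apply)
  then show ?thesis
    unfolding returning_def using s w(1) W_alg_aut(2) by blast
qed

text \<open>Otherwise prime avoidance yields a single \<open>s\<close> in \<open>S\<close> that maps
  all of \<open>m\<close> into \<open>P\<close>, and \<open>returningI\<close> places it in
  \<open>returning\<close>.\<close>

lemma exists_avoiding:
  assumes "finite S" "S \<subseteq> M - returning"
  shows "\<exists>\<gamma>\<in>m. \<forall>s\<in>S. s \<gamma> \<notin> P"
proof (rule ccontr)
  assume neg: "\<not> ?thesis"
  have "\<exists>s\<in>S. \<forall>x\<in>m. s x \<in> P"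
  proof (rule prime_avoidance_preimages)
    show "S \<subseteq> carrier (alg_aut scale)"
      using assms(2) M_D by blast
    show "m \<noteq> {}"
      using m_D(2) by blast
    show "\<exists>s\<in>S. s x \<in> P" if "x \<in> m" for x
      using neg that by blast
    show "x * y \<in> m" if "x \<in> m" "y \<in> m" for x y
      using m_D(5)[OF that(2)] m_D(1) that(1) by blast
  qed (use assms(1) m_D(3) in auto)
  then show False
    using returningI assms(2) by blast
qed

section \<open>\<open>U\<close> as a module over \<Gamma> and over the base field\<close>

lemma U_subring: "subring U (KK_ring M W)"
  using galois_order by (simp add: galois_order_def galois_ring_def)

lemma U_KK: "u \<in> U \<Longrightarrow> u \<in> carrier (KK_ring M W)"
  using subgroup.subset[OF subring.axioms(1)[OF U_subring]] by auto

lemma U_supp: "u \<in> U \<Longrightarrow> finite (supp u)" "u \<in> U \<Longrightarrow> supp u \<subseteq> M"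
  using U_KK[of u] by (auto simp: KK_iff)

lemma U_closed:
  shows "u \<in> U \<Longrightarrow> v \<in> U \<Longrightarrow> u + v \<in> U" "0 \<in> U" "coeff_emb 1 \<in> U"
    "u \<in> U \<Longrightarrow> v \<in> U \<Longrightarrow> u \<otimes>\<^bsub>skew_ring M\<^esub> v \<in> U"
  using subgroup.m_closed[OF subring.axioms(1)[OF U_subring], of u v]
    subgroup.one_closed[OF subring.axioms(1)[OF U_subring]]
    submonoid.m_closed[OF subring.axioms(2)[OF U_subring], of u v]
    submonoid.one_closed[OF subring.axioms(2)[OF U_subring]] by simp_all

lemma Gamma_emb_U: "a \<in> Gamma W \<Longrightarrow> Gamma_emb a \<in> U"
  using galois_order by (auto simp: galois_order_def galois_ring_def)

lemma Gamma_mult_left: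
  "u \<in> U \<Longrightarrow> Gamma_emb a \<otimes>\<^bsub>skew_ring M\<^esub> u = (\<lambda>\<rho>. to_fract a * u \<rho>)"
  by (simp add: Gamma_emb_def skew_mult_coeff_left U_supp)

text \<open>Moving \<open>a\<close> past \<open>\<rho>\<close> applies \<open>\<rho>\<close> to it.
  Right multiplication can thus distinguish elements of the support, while left multiplication
  scales all coefficients alike.\<close>

lemma Gamma_mult_right:
  assumes "u \<in> U"
  shows "u \<otimes>\<^bsub>skew_ring M\<^esub> Gamma_emb a = (\<lambda>\<rho>. to_fract (\<rho> a) * u \<rho>)"
proof -
  have eq: "u \<rho> * frac_map \<rho> (to_fract a) = to_fract (\<rho> a) * u \<rho>" for \<rho>
    using U_supp(2)[OF assms] frac_map_to_fract[OF M_D, of \<rho> a] by (cases "\<rho> \<in> M") (auto simp: supp_def)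
  show ?thesis
    unfolding Gamma_emb_def skew_mult_coeff_right[OF U_supp[OF assms]] eq ..
qed

text \<open>Defined on all functions and not only on \<open>U\<close>, so that the theory of vector
  spaces on a type applies and \<open>U\<close> becomes a subspace.\<close>

definition kscale :: "'k \<Rightarrow> 'a skew \<Rightarrow> 'a skew" where
  "kscale c u = (\<lambda>\<rho>. to_fract (scale c 1) * u \<rho>)"

lemma scale_one_mult: "scale (c * d) 1 = scale c 1 * scale d 1"
  using scale_mult_left[of c 1 "scale d 1"] by (simp add: scale_scale)

sublocale skew: vector_space kscale
  by unfold_locales
    (simp_all add: fun_eq_iff kscale_def algebra_simps scale_left_distrib scale_one_mult)

text \<open>The elements of \<open>M\<close> fix the scalars, so the products from the left and from
  the right agree.\<close>

lemma kscale_mult: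
  assumes "u \<in> U"
  shows "k_emb scale c \<otimes>\<^bsub>skew_ring M\<^esub> u = kscale c u"
    and "u \<otimes>\<^bsub>skew_ring M\<^esub> k_emb scale c = kscale c u"
proof -
  show "k_emb scale c \<otimes>\<^bsub>skew_ring M\<^esub> u = kscale c u"
    using Gamma_mult_left[OF assms] by (simp add: k_emb_def kscale_def)
  have eq: "to_fract (\<rho> (scale c 1)) * u \<rho> = to_fract (scale c 1) * u \<rho>" for \<rho>
    using U_supp(2)[OF assms] alg_autD(4,8)[OF M_D, of \<rho>] by (cases "\<rho> \<in> M") (auto simp: supp_def)
  show "u \<otimes>\<^bsub>skew_ring M\<^esub> k_emb scale c = kscale c u"
    unfolding k_emb_def kscale_def Gamma_mult_right[OF assms] eq ..
qed

lemma k_emb_U: "k_emb scale c \<in> U"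
  unfolding k_emb_def using Gamma_emb_U Gamma_closed(2,7) by blast

lemma kscale_U: "u \<in> U \<Longrightarrow> kscale c u \<in> U"
  using U_closed(4)[OF k_emb_U, of u c] by (simp add: kscale_mult)

lemma kscale_minus_one: "kscale (- 1) u = - u"
  by (simp add: kscale_def fun_eq_iff)

lemma U_uminus: "u \<in> U \<Longrightarrow> - u \<in> U"
  using kscale_U[of u "- 1"] by (simp add: kscale_minus_one)

lemma subspace_U: "skew.subspace U"
proof (rule skew.subspaceI)
  show "u + v \<in> U" if "u \<in> U" "v \<in> U" for u v
    using U_closed(1)[OF that] .
qed (simp_all add: U_closed(2) kscale_U)

definition U0 :: "'a skew set" where
  "U0 = {u \<in> U. supp u \<subseteq> returning}"

lemma submodule_right_U: "submodule U (Gamma_ring W) (right_KK M W Gamma_emb)"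
proof (intro submodule.intro submodule_axioms.intro additive_subgroupI)
  show "a \<odot>\<^bsub>right_KK M W Gamma_emb\<^esub> u \<in> U" if "a \<in> carrier (Gamma_ring W)" "u \<in> U" for a u
  proof -
    have "a \<in> Gamma W"
      using that(1) by (simp add: Gamma_ring_def)
    then show ?thesis
      using U_closed(4)[OF that(2) Gamma_emb_U] by simp
  qed
  show "u + v \<in> U" if "u \<in> U" "v \<in> U" for u v
    using U_closed(1)[OF that] .
qed (use U_KK U_uminus U_closed(2) in auto)

text \<open>The order condition is applied to the left \<open>K\<close>-space of invariants
  supported in the finite set \<open>returning\<close>, whose intersection with \<open>U\<close> is
  \<open>U0\<close>. Generation on the right is the side needed: there the coefficients from
  \<Gamma> reach a vector before the generators do. The generators lie in \<open>U\<close> because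
  \<open>U\<close> is a right \<Gamma>-submodule.\<close>

lemma U0_finitely_generated:
  obtains T where "finite T" "T \<subseteq> U" "U0 \<subseteq> mod_span (Gamma_ring W) (right_KK M W Gamma_emb) T"
proof -
  let ?R = "Gamma_ring W" and ?E = "right_KK M W Gamma_emb"
  let ?V = "{x \<in> carrier (KK_ring M W). supp x \<subseteq> returning}"
  have UV: "U \<inter> ?V = U0"
    using U_KK by (auto simp: U0_def)
  have "fin_gen ?R ?E (mod_span ?R ?E (U \<inter> ?V))"
    using galois_order fin_gen_bounded_support[OF finite_returning]
    unfolding galois_order_def by blast
  then obtain T where T: "finite T" "T \<subseteq> carrier ?E" "mod_span ?R ?E U0 = mod_span ?R ?E T"
    unfolding UV fin_gen_def by blast
  have "T \<subseteq> mod_span ?R ?E T" "U0 \<subseteq> mod_span ?R ?E U0"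
    by (auto simp: mod_span_def)
  moreover have "mod_span ?R ?E U0 \<subseteq> U"
    using submodule_right_U by (auto simp: mod_span_def U0_def)
  ultimately show thesis
    using T by (intro that[of T]) auto
qed

section \<open>Twisting by polynomials over \<Gamma>\<close>

definition twist :: "'a poly \<Rightarrow> 'a \<Rightarrow> 'a skew \<Rightarrow> 'a skew" where
  "twist p \<gamma> u = (\<lambda>\<rho>. to_fract (poly p (\<rho> \<gamma>)) * u \<rho>)"

lemma twist_0: "twist 0 \<gamma> u = 0"
  by (simp add: twist_def fun_eq_iff)

text \<open>Horner's rule. Right multiplication by \<open>\<gamma>\<close> multiplies the
  coefficient at \<open>\<rho>\<close> by \<open>\<rho> \<gamma>\<close>, so the twist by
  \<open>\<Sum>\<^sub>i c\<^sub>i X\<^sup>i\<close> is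
  \<open>\<Sum>\<^sub>i c\<^sub>i u \<gamma>\<^sup>i\<close>.\<close>

lemma twist_pCons:
  assumes "u \<in> U" "twist p \<gamma> u \<in> U"
  shows "twist (pCons c p) \<gamma> u =
    Gamma_emb c \<otimes>\<^bsub>skew_ring M\<^esub> u + twist p \<gamma> u \<otimes>\<^bsub>skew_ring M\<^esub> Gamma_emb \<gamma>"
  using assms by (simp add: Gamma_mult_left Gamma_mult_right) (simp add: twist_def fun_eq_iff algebra_simps)

lemma twist_U:
  assumes "u \<in> U" "\<gamma> \<in> Gamma W" "\<And>i. coeff p i \<in> Gamma W"
  shows "twist p \<gamma> u \<in> U"
  using assms(3)
proof (induction p)
  case 0
  then show ?case
    unfolding twist_0 by (intro U_closed(2))
next
  case (pCons c p)
  have "coeff p i \<in> Gamma W" for i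
    using pCons.prems[of "Suc i"] by simp
  then have p: "twist p \<gamma> u \<in> U"
    by (rule pCons.IH)
  have "c \<in> Gamma W"
    using pCons.prems[of 0] by simp
  then show ?case
    unfolding twist_pCons[OF assms(1) p] by (intro U_closed(1,4) Gamma_emb_U assms(1,2) p)
qed

text \<open>Invariance of \<open>u\<close> under \<open>w\<close> says that its coefficient at the
  conjugate of \<open>s\<close> is the image under \<open>w\<close> of the coefficient at
  \<open>s\<close>.\<close>

lemma supp_conj:
  assumes "u \<in> U" "w \<in> W" "s \<in> supp u"
  shows "w \<circ> s \<circ> inv_into UNIV w \<in> supp u"
proof -
  let ?v = "inv_into UNIV w"
  have v: "?v \<in> W"
    using W_alg_aut(4)[OF assms(2)] .
  have "inv_into UNIV w \<circ> (w \<circ> s \<circ> ?v) \<circ> w = s"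
    using inv_into_comp_aut[OF W_D[OF assms(2)]] by (simp add: fun_eq_iff)
  then have "frac_map w (u s) = u (w \<circ> s \<circ> ?v)"
    using U_KK[OF assms(1)] assms(2) unfolding KK_iff by metis
  then show ?thesis
    using assms(3) frac_map_hom(4)[OF W_D[OF assms(2)], of "u s"] by (simp add: supp_def)
qed

text \<open>\<open>W\<close> permutes the roots: as \<open>w\<close> fixes \<open>\<gamma>\<close>,
  applying \<open>w\<close> to \<open>s \<gamma>\<close> gives the value at \<open>\<gamma>\<close>
  of the conjugate of \<open>s\<close> by \<open>w\<close>.\<close>

lemma conj_invariant_poly:
  assumes S: "finite S" "\<And>w s. w \<in> W \<Longrightarrow> s \<in> S \<Longrightarrow> w \<circ> s \<circ> inv_into UNIV w \<in> S"
    and \<gamma>: "\<gamma> \<in> Gamma W"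
  shows "coeff (\<Prod>s\<in>S. [:- s \<gamma>, 1:]) i \<in> Gamma W"
proof -
  have "w (coeff (\<Prod>s\<in>S. [:- s \<gamma>, 1:]) i) = coeff (\<Prod>s\<in>S. [:- s \<gamma>, 1:]) i" if w: "w \<in> W" for w
  proof -
    note wD = alg_autD[OF W_D[OF w]] and w_inv = inv_into_comp_aut[OF W_D[OF w]]
    have lin: "map_poly w [:- s \<gamma>, 1:] = [:- w (s \<gamma>), 1:]" for s
      by (simp add: map_poly_pCons wD)
    have mult: "map_poly w (p * q) = map_poly w p * map_poly w q" for p q
      by (rule map_poly_hom(2)) (simp_all add: wD)
    have prod: "map_poly w (\<Prod>s\<in>A. [:- s \<gamma>, 1:]) = (\<Prod>s\<in>A. [:- w (s \<gamma>), 1:])" for A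
      by (induction A rule: infinite_finite_induct)
        (simp_all add: mult lin map_poly_1' wD(4) del: mult_pCons_left)
    let ?c = "\<lambda>s. w \<circ> s \<circ> inv_into UNIV w"
    have inj: "inj_on ?c S"
    proof (rule inj_onI)
      fix s t assume eq: "?c s = ?c t"
      have recover: "u x = inv_into UNIV w (?c u (w x))" for u x
        by (simp add: w_inv)
      show "s = t"
        by (rule ext) (simp only: recover[of s] recover[of t] eq)
    qed
    then have "?c ` S = S"
      using S(1) S(2)[OF w] by (intro endo_inj_surj) auto
    then have bij: "bij_betw ?c S S"
      using inj by (simp add: bij_betw_def)
    have "inv_into UNIV w \<gamma> = \<gamma>"
      using GammaD[OF \<gamma> W_alg_aut(4)[OF w]] .
    then have "(\<Prod>s\<in>S. [:- w (s \<gamma>), 1:]) = (\<Prod>s\<in>S. [:- ?c s \<gamma>, 1:])"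
      by simp
    also have "\<dots> = (\<Prod>s\<in>S. [:- s \<gamma>, 1:])"
      by (rule prod.reindex_bij_betw[OF bij])
    finally show ?thesis
      using prod[of S] coeff_map_poly[of w "\<Prod>s\<in>S. [:- s \<gamma>, 1:]" i] wD(5) by simp
  qed
  then show ?thesis
    by (simp add: Gamma_def)
qed

text \<open>Twisting \<open>u\<close> by the polynomial with roots \<open>s \<gamma>\<close>, where \<open>s\<close> runs through the part of the
  support of \<open>u\<close> outside \<open>returning\<close>, removes this part; modulo \<open>U m\<close> it multiplies \<open>u\<close> by the
  constant coefficient, which can be made invertible at \<open>m\<close>.\<close>

lemma exists_twist:
  assumes "u \<in> U"
  obtains p \<gamma> where "\<gamma> \<in> m" "\<And>i. coeff p i \<in> Gamma W" "coeff p 0 \<notin> m" "twist p \<gamma> u \<in> U0"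
proof -
  define S where "S = supp u - returning"
  have S: "finite S" "S \<subseteq> M - returning"
    using U_supp[OF assms] by (auto simp: S_def)
  obtain \<gamma> where \<gamma>: "\<gamma> \<in> m" "\<And>s. s \<in> S \<Longrightarrow> s \<gamma> \<notin> P"
    using exists_avoiding[OF S] by blast
  define p where "p = (\<Prod>s\<in>S. [:- s \<gamma>, 1:])"
  have \<gamma>G: "\<gamma> \<in> Gamma W"
    using \<gamma>(1) m_D(1) by blast
  \<comment> \<open>Both \<open>supp u\<close> and \<open>returning\<close> are stable under
    conjugation; for the complement of \<open>returning\<close> one conjugates back by the inverse
    of \<open>w\<close>.\<close>
  have conj: "w \<circ> s \<circ> inv_into UNIV w \<in> S" if "w \<in> W" "s \<in> S" for w s
  proof -
    have "s \<in> returning" if "w \<circ> s \<circ> inv_into UNIV w \<in> returning"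
    proof -
      let ?v = "inv_into UNIV w"
      have "?v \<circ> (w \<circ> s \<circ> ?v) \<circ> inv_into UNIV ?v = s"
        using inv_into_comp_aut[OF W_D[OF \<open>w \<in> W\<close>]]
        by (simp add: fun_eq_iff inv_into_inv_into_aut[OF W_D[OF \<open>w \<in> W\<close>]])
      then show ?thesis
        using returning_conj[OF W_alg_aut(4)[OF \<open>w \<in> W\<close>] that] by simp
    qed
    then show ?thesis
      using that supp_conj[OF assms, of w s] by (auto simp: S_def)
  qed
  have coeffs: "coeff p i \<in> Gamma W" for i
    unfolding p_def by (rule conj_invariant_poly[OF S(1) conj \<gamma>G])
  have "coeff p 0 = (\<Prod>s\<in>S. - s \<gamma>)"
    unfolding poly_0_coeff_0[symmetric] p_def by (simp add: poly_prod)
  moreover have "- s \<gamma> \<notin> P" if "s \<in> S" for s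
    using \<gamma>(2)[OF that] P_D(4)[of "- s \<gamma>"] by auto
  ultimately have "coeff p 0 \<notin> P"
    using prod_in_P[OF S(1)] by simp
  then have "coeff p 0 \<notin> m"
    using lies_over by blast
  moreover have "supp (twist p \<gamma> u) \<subseteq> returning"
  proof
    fix \<rho> assume "\<rho> \<in> supp (twist p \<gamma> u)"
    then have "poly p (\<rho> \<gamma>) \<noteq> 0" "\<rho> \<in> supp u"
      by (auto simp: supp_def twist_def)
    then show "\<rho> \<in> returning"
      using S(1) by (auto simp: p_def poly_prod S_def)
  qed
  ultimately show thesis
    using that[of \<gamma> p] \<gamma>(1) coeffs twist_U[OF assms \<gamma>G coeffs] by (simp add: U0_def)
qed

end

section \<open>Weight vectors and weight spaces\<close>

lemma module_isomorphic_sym: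
  assumes "left_module R E" "module_isomorphic R E F"
  shows "module_isomorphic R F E"
proof -
  interpret E: left_module R E
    by fact
  obtain f where f: "f \<in> iso (add_monoid E) (add_monoid F)"
    and lin: "\<And>r x. r \<in> carrier R \<Longrightarrow> x \<in> carrier E \<Longrightarrow> f (r \<odot>\<^bsub>E\<^esub> x) = r \<odot>\<^bsub>F\<^esub> f x"
    using assms(2) by (auto simp: module_isomorphic_def)
  have bij: "bij_betw f (carrier E) (carrier F)"
    using f by (simp add: iso_def)
  define g where "g = inv_into (carrier E) f"
  have "g \<in> iso (add_monoid F) (add_monoid E)"
    using group.iso_set_sym[OF E.E.add.is_group f] by (simp add: g_def)
  moreover have "g (r \<odot>\<^bsub>F\<^esub> y) = r \<odot>\<^bsub>E\<^esub> g y" if r: "r \<in> carrier R" and y: "y \<in> carrier F" for r y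
  proof -
    obtain x where x: "x \<in> carrier E" "y = f x"
      using bij y by (auto simp: bij_betw_def)
    have "g (f z) = z" if "z \<in> carrier E" for z
      unfolding g_def using bij that by (simp add: bij_betw_def)
    then show ?thesis
      using E.smult_closed[OF r x(1)] x by (simp flip: lin[OF r x(1)])
  qed
  ultimately show ?thesis
    by (auto simp: module_isomorphic_def)
qed

lemma module_isomorphic_trans:
  assumes "module_isomorphic R E F" "module_isomorphic R F G"
  shows "module_isomorphic R E G"
proof -
  obtain f where f: "f \<in> iso (add_monoid E) (add_monoid F)"
    and f_lin: "\<And>r x. r \<in> carrier R \<Longrightarrow> x \<in> carrier E \<Longrightarrow> f (r \<odot>\<^bsub>E\<^esub> x) = r \<odot>\<^bsub>F\<^esub> f x"
    using assms(1) by (auto simp: module_isomorphic_def)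
  obtain g where g: "g \<in> iso (add_monoid F) (add_monoid G)"
    and g_lin: "\<And>r x. r \<in> carrier R \<Longrightarrow> x \<in> carrier F \<Longrightarrow> g (r \<odot>\<^bsub>F\<^esub> x) = r \<odot>\<^bsub>G\<^esub> g x"
    using assms(2) by (auto simp: module_isomorphic_def)
  have "f x \<in> carrier F" if "x \<in> carrier E" for x
    using f that by (auto simp: iso_def bij_betw_def)
  then have "(g \<circ> f) (r \<odot>\<^bsub>E\<^esub> x) = r \<odot>\<^bsub>G\<^esub> (g \<circ> f) x" if "r \<in> carrier R" "x \<in> carrier E" for r x
    using that f_lin g_lin by simp
  moreover have "g \<circ> f \<in> iso (add_monoid E) (add_monoid G)"
    using iso_set_trans[OF f g] by (simp add: compose_def)
  ultimately show ?thesis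
    unfolding module_isomorphic_def by blast
qed

context galois_order_at
begin

lemma U_ring_simps:
  "carrier (U_ring M U) = U" "monoid.mult (U_ring M U) = monoid.mult (skew_ring M)"
  "add (U_ring M U) = (+)" "ring.zero (U_ring M U) = 0" "one (U_ring M U) = coeff_emb 1"
  by (simp_all add: U_ring_def skew_ring_def fun_eq_iff)

section \<open>Powers of \<open>m\<close>\<close>

abbreviation m_power :: "nat \<Rightarrow> 'a set" where
  "m_power n \<equiv> m [^]\<^bsub>ideals_set (Gamma_ring W)\<^esub> n"

lemma m_power_0: "m_power 0 = Gamma W"
  by (simp add: nat_pow_def ideals_set_def Gamma_ring_def)

lemma m_power_Suc: "m_power (Suc n) = ideal_prod (Gamma_ring W) (m_power n) m"
  by (simp add: nat_pow_def ideals_set_def)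

lemma m_power_mult: "x \<in> m_power n \<Longrightarrow> y \<in> m \<Longrightarrow> x * y \<in> m_power (Suc n)"
  unfolding m_power_Suc using ideal_prod.prod[of x "m_power n" y m "Gamma_ring W"]
  by (simp add: Gamma_ring_def ring_of_type_algebra_def)

lemma pow_mem_m_power: "x \<in> m \<Longrightarrow> x ^ n \<in> m_power n"
proof (induction n)
  case (Suc n)
  then show ?case
    using m_power_mult[of "x ^ n" n x] by (simp only: power_Suc2)
next
  case 0
  show ?case
    unfolding m_power_0 by (simp add: Gamma_closed(2))
qed

lemma m_power_subset: "m_power n \<subseteq> Gamma W"
proof (induction n)
  case (Suc n)
  show ?case
  proof
    fix x assume "x \<in> m_power (Suc n)"
    then have "x \<in> ideal_prod (Gamma_ring W) (m_power n) m"
      by (simp only: m_power_Suc)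
    then show "x \<in> Gamma W"
    proof (induction rule: ideal_prod.induct)
      case (prod a b)
      then show ?case
        using Suc.IH m_D(1) Gamma_closed(4)[of a b] by (auto simp: Gamma_ring_def ring_of_type_algebra_def)
    next
      case (sum a b)
      then show ?case
        using Gamma_closed(3)[of a b] by (simp add: Gamma_ring_def ring_of_type_algebra_def)
    qed
  qed
next
  case 0
  show ?case
    unfolding m_power_0 ..
qed

text \<open>Here \<open>m\<close> itself, and not just a power of it, annihilates \<open>v\<close>.
  The module condition is included so that later statements can quantify over all modules and
  vectors at once.\<close>

definition weight_vector :: "('a skew, 'm, 'q) module_scheme \<Rightarrow> 'm \<Rightarrow> bool" where
  "weight_vector E v \<longleftrightarrow> left_module (U_ring M U) E \<and> v \<in> carrier E \<and>
     (\<forall>a\<in>m. Gamma_emb a \<odot>\<^bsub>E\<^esub> v = \<zero>\<^bsub>E\<^esub>)"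

section \<open>The action of \<open>U\<close> on a fixed module\<close>

context
  fixes E :: "('a skew, 'm, 'q) module_scheme" (structure)
  assumes left_module_E: "left_module (U_ring M U) E"
begin

interpretation E: left_module "U_ring M U" E
  by (rule left_module_E)

lemma act_closed: "u \<in> U \<Longrightarrow> x \<in> carrier E \<Longrightarrow> u \<odot> x \<in> carrier E"
  using E.smult_closed by (simp add: U_ring_simps)

lemma act_add_left: "u \<in> U \<Longrightarrow> v \<in> U \<Longrightarrow> x \<in> carrier E \<Longrightarrow> (u + v) \<odot> x = u \<odot> x \<oplus> v \<odot> x"
  using E.smult_l_distr by (simp add: U_ring_simps)

lemma act_add_right: "u \<in> U \<Longrightarrow> x \<in> carrier E \<Longrightarrow> y \<in> carrier E \<Longrightarrow> u \<odot> (x \<oplus> y) = u \<odot> x \<oplus> u \<odot> y"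
  using E.smult_r_distr by (simp add: U_ring_simps)

lemma act_mult: "u \<in> U \<Longrightarrow> v \<in> U \<Longrightarrow> x \<in> carrier E \<Longrightarrow> (u \<otimes>\<^bsub>skew_ring M\<^esub> v) \<odot> x = u \<odot> (v \<odot> x)"
  using E.smult_assoc by (simp add: U_ring_simps)

lemma act_one: "x \<in> carrier E \<Longrightarrow> coeff_emb 1 \<odot> x = x"
  using E.smult_one by (simp add: U_ring_simps)

lemma act_zero_left: "x \<in> carrier E \<Longrightarrow> 0 \<odot> x = \<zero>"
  using E.smult_l_null by (simp add: U_ring_simps)

lemma act_zero_right: "u \<in> U \<Longrightarrow> u \<odot> \<zero> = \<zero>"
  using E.smult_r_null by (simp add: U_ring_simps)

lemma act_kscale:
  assumes "u \<in> U" "x \<in> carrier E"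
  shows "kscale c u \<odot> x = k_emb scale c \<odot> (u \<odot> x)" "u \<odot> (k_emb scale c \<odot> x) = k_emb scale c \<odot> (u \<odot> x)"
  using act_mult[OF k_emb_U assms, of c] act_mult[OF assms(1) k_emb_U assms(2), of c]
    kscale_mult[OF assms(1), of c] by simp_all

lemma Gamma_emb_hom:
  assumes "a \<in> Gamma W" "b \<in> Gamma W" "x \<in> carrier E"
  shows "Gamma_emb (a + b) \<odot> x = Gamma_emb a \<odot> x \<oplus> Gamma_emb b \<odot> x"
    and "Gamma_emb (a * b) \<odot> x = Gamma_emb a \<odot> (Gamma_emb b \<odot> x)"
proof -
  have "Gamma_emb (a + b) = Gamma_emb a + Gamma_emb b"
    by (simp add: Gamma_emb_def coeff_emb_def fun_eq_iff)
  then show "Gamma_emb (a + b) \<odot> x = Gamma_emb a \<odot> x \<oplus> Gamma_emb b \<odot> x"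
    using assms by (simp only: act_add_left Gamma_emb_U)
  have "Gamma_emb a \<otimes>\<^bsub>skew_ring M\<^esub> Gamma_emb b = Gamma_emb (a * b)"
    unfolding Gamma_mult_left[OF Gamma_emb_U[OF assms(2)]]
    by (simp add: Gamma_emb_def coeff_emb_def fun_eq_iff)
  then show "Gamma_emb (a * b) \<odot> x = Gamma_emb a \<odot> (Gamma_emb b \<odot> x)"
    using act_mult[of "Gamma_emb a" "Gamma_emb b" x] assms Gamma_emb_U by simp
qed

lemma Gamma_emb_one: "x \<in> carrier E \<Longrightarrow> Gamma_emb 1 \<odot> x = x"
  by (simp add: Gamma_emb_def act_one)

text \<open>Every term of the twist but the constant one ends in a right factor
  \<open>\<gamma>\<close>, which annihilates \<open>v\<close>.\<close>

lemma act_twist: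
  assumes "u \<in> U" "\<gamma> \<in> m" "\<And>i. coeff p i \<in> Gamma W" and v: "weight_vector E v"
  shows "twist p \<gamma> u \<odot> v = Gamma_emb (coeff p 0) \<odot> (u \<odot> v)"
proof -
  have \<gamma>: "\<gamma> \<in> Gamma W"
    using assms(2) m_D(1) by blast
  have vE: "v \<in> carrier E" "Gamma_emb \<gamma> \<odot> v = \<zero>"
    using v assms(2) by (auto simp: weight_vector_def)
  obtain c q where pCons: "p = pCons c q"
    by (rule pCons_cases)
  show ?thesis
  proof -
    have "coeff q i \<in> Gamma W" for i
      using assms(3)[of "Suc i"] by (simp add: pCons)
    then have q: "twist q \<gamma> u \<in> U"
      using twist_U assms(1) \<gamma> by blast
    have c: "c \<in> Gamma W"
      using assms(3)[of 0] by (simp add: pCons)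
    let ?a = "Gamma_emb c \<otimes>\<^bsub>skew_ring M\<^esub> u" and ?b = "twist q \<gamma> u \<otimes>\<^bsub>skew_ring M\<^esub> Gamma_emb \<gamma>"
    have "?a \<in> U" "?b \<in> U"
      using U_closed(4) Gamma_emb_U assms(1) c \<gamma> q by blast+
    then have "twist p \<gamma> u \<odot> v = ?a \<odot> v \<oplus> ?b \<odot> v"
      unfolding pCons twist_pCons[OF assms(1) q] using vE by (simp only: act_add_left)
    also have "?b \<odot> v = \<zero>"
      using act_mult[OF q Gamma_emb_U[OF \<gamma>] vE(1)] vE(2) act_zero_right[OF q] by simp
    also have "?a \<odot> v = Gamma_emb c \<odot> (u \<odot> v)"
      using act_mult[OF Gamma_emb_U[OF c] assms(1) vE(1)] .
    finally show ?thesis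
      using act_closed[OF Gamma_emb_U[OF c] act_closed[OF assms(1) vE(1)]] by (simp add: pCons)
  qed
qed

text \<open>An inverse \<open>h0\<close> of \<open>g\<close> modulo \<open>m\<close> is corrected by
  a geometric sum: for \<open>x = 1 - h0 * g\<close> in \<open>m\<close> some power
  \<open>x ^ N\<close> annihilates \<open>z\<close>, and \<open>s = (\<Sum>i<N. x ^ i)\<close>
  satisfies \<open>s * h0 * g = 1 - x ^ N\<close>.\<close>

lemma weight_space_unit:
  assumes "z \<in> weight_space W E m" "g \<in> Gamma W" "g \<notin> m"
  shows "\<exists>h\<in>Gamma W. Gamma_emb h \<odot> (Gamma_emb g \<odot> z) = z"
proof -
  obtain N where zE: "z \<in> carrier E"
    and N: "\<And>a. a \<in> m_power N \<Longrightarrow> Gamma_emb a \<odot> z = \<zero>"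
    using assms(1) unfolding weight_space_def by blast
  obtain h0 where h0: "h0 \<in> Gamma W" "1 - h0 * g \<in> m"
    using m_inverse[OF assms(2,3)] by blast
  define x where "x = 1 - h0 * g"
  have xG: "x \<in> Gamma W"
    using h0(2) m_D(1) by (auto simp: x_def)
  have pow: "x ^ i \<in> Gamma W" for i
    by (induction i) (simp_all add: Gamma_closed xG)
  define s where "s = (\<Sum>i<N. x ^ i)"
  have "(\<Sum>i<n. x ^ i) \<in> Gamma W" for n
    by (induction n) (simp_all add: Gamma_closed pow)
  then have s: "s \<in> Gamma W"
    by (simp add: s_def)
  have "1 - x ^ N = (1 - x) * s"
    unfolding s_def by (rule one_diff_power_eq)
  then have one: "1 = (s * h0) * g + x ^ N"
    by (simp add: x_def algebra_simps)
  have sh: "s * h0 \<in> Gamma W"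
    using s h0(1) by (rule Gamma_closed)
  have "z = Gamma_emb ((s * h0) * g + x ^ N) \<odot> z"
    using Gamma_emb_one[OF zE] by (simp flip: one)
  also have "\<dots> = Gamma_emb ((s * h0) * g) \<odot> z \<oplus> Gamma_emb (x ^ N) \<odot> z"
    by (rule Gamma_emb_hom(1)[OF Gamma_closed(4)[OF sh assms(2)] pow zE])
  also have "Gamma_emb (x ^ N) \<odot> z = \<zero>"
    using pow_mem_m_power[OF h0(2)] by (intro N) (simp add: x_def)
  also have "Gamma_emb ((s * h0) * g) \<odot> z = Gamma_emb (s * h0) \<odot> (Gamma_emb g \<odot> z)"
    by (rule Gamma_emb_hom(2)[OF sh assms(2) zE])
  finally have "Gamma_emb (s * h0) \<odot> (Gamma_emb g \<odot> z) = z"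
    using act_closed[OF Gamma_emb_U[OF sh] act_closed[OF Gamma_emb_U[OF assms(2)] zE]] by simp
  then show ?thesis
    using sh by blast
qed

section \<open>The weight space of \<open>m\<close>\<close>

lemma weight_spaceI:
  assumes "z \<in> carrier E" "\<And>n a. n \<ge> N \<Longrightarrow> a \<in> m_power n \<Longrightarrow> Gamma_emb a \<odot> z = \<zero>"
  shows "z \<in> weight_space W E m"
  using assms unfolding weight_space_def by blast

lemma weight_space_add:
  assumes "x \<in> weight_space W E m" "y \<in> weight_space W E m"
  shows "x \<oplus> y \<in> weight_space W E m"
proof -
  obtain N where x: "x \<in> carrier E" "\<And>n a. n \<ge> N \<Longrightarrow> a \<in> m_power n \<Longrightarrow> Gamma_emb a \<odot> x = \<zero>"
    using assms(1) unfolding weight_space_def by blast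
  obtain N' where y: "y \<in> carrier E" "\<And>n a. n \<ge> N' \<Longrightarrow> a \<in> m_power n \<Longrightarrow> Gamma_emb a \<odot> y = \<zero>"
    using assms(2) unfolding weight_space_def by blast
  show ?thesis
  proof (rule weight_spaceI[where N = "max N N'"])
    fix n a assume n: "n \<ge> max N N'" and a: "a \<in> m_power n"
    have "Gamma_emb a \<in> U"
      using a m_power_subset Gamma_emb_U by blast
    then show "Gamma_emb a \<odot> (x \<oplus> y) = \<zero>"
      using act_add_right[of "Gamma_emb a" x y] x(1) y(1) x(2)[OF _ a] y(2)[OF _ a] n by simp
  qed (simp add: x(1) y(1))
qed

lemma weight_space_zero: "\<zero> \<in> weight_space W E m"
  using m_power_subset by (intro weight_spaceI act_zero_right Gamma_emb_U) auto

lemma weight_space_k_emb: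
  assumes "x \<in> weight_space W E m"
  shows "k_emb scale c \<odot> x \<in> weight_space W E m"
proof -
  obtain N where x: "x \<in> carrier E" "\<And>n a. n \<ge> N \<Longrightarrow> a \<in> m_power n \<Longrightarrow> Gamma_emb a \<odot> x = \<zero>"
    using assms(1) unfolding weight_space_def by blast
  show ?thesis
  proof (rule weight_spaceI[where N = N])
    fix n a assume n: "n \<ge> N" and a: "a \<in> m_power n"
    have "Gamma_emb a \<in> U"
      using a m_power_subset Gamma_emb_U by blast
    then show "Gamma_emb a \<odot> (k_emb scale c \<odot> x) = \<zero>"
      using act_kscale(2)[of "Gamma_emb a" x c] x(1) x(2)[OF n a] act_zero_right[OF k_emb_U] by simp
  qed (rule act_closed[OF k_emb_U x(1)])
qed

text \<open>For the least \<open>n\<close> such that the \<open>n\<close>-th power of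
  \<open>m\<close> annihilates \<open>z\<close>, some \<open>a\<close> in the preceding power has
  \<open>a z \<noteq> 0\<close>, and \<open>m\<close> annihilates \<open>a z\<close>.\<close>

lemma exists_weight_vector:
  assumes "weight_space W E m \<noteq> {\<zero>}"
  shows "\<exists>v. weight_vector E v \<and> v \<noteq> \<zero>"
proof -
  obtain z where z: "z \<in> weight_space W E m" "z \<noteq> \<zero>"
    using assms weight_space_zero by blast
  then have zE: "z \<in> carrier E"
    by (simp add: weight_space_def)
  define kills where "kills n \<longleftrightarrow> (\<forall>a \<in> m_power n. Gamma_emb a \<odot> z = \<zero>)" for n :: nat
  have ex: "\<exists>n. kills n"
    using z(1) unfolding weight_space_def kills_def by blast
  define n where "n = (LEAST n. kills n)"
  have n: "kills n"
    unfolding n_def using ex by (rule LeastI_ex)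
  \<comment> \<open>The zeroth power of \<open>m\<close> is \<Gamma>, which contains 1, so the least
    exponent is positive.\<close>
  have "\<not> kills 0"
    using Gamma_closed(2) Gamma_emb_one[OF zE] z(2) unfolding kills_def m_power_0 by metis
  then obtain n' where n': "n = Suc n'"
    using n by (cases n) auto
  then have "\<not> kills n'"
    using not_less_Least[of n' kills] unfolding n_def by simp
  then obtain a where a: "a \<in> m_power n'" "Gamma_emb a \<odot> z \<noteq> \<zero>"
    unfolding kills_def by blast
  have aG: "a \<in> Gamma W"
    using a(1) m_power_subset by blast
  have "Gamma_emb b \<odot> (Gamma_emb a \<odot> z) = \<zero>" if b: "b \<in> m" for b
  proof -
    have "Gamma_emb (b * a) \<odot> z = \<zero>"
      using n m_power_mult[OF a(1) b] by (simp add: kills_def n' mult.commute)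
    then show ?thesis
      using Gamma_emb_hom(2)[OF _ aG zE, of b] b m_D(1) by auto
  qed
  then have "weight_vector E (Gamma_emb a \<odot> z)"
    using left_module_E act_closed[OF Gamma_emb_U[OF aG] zE] by (simp add: weight_vector_def)
  then show ?thesis
    using a(2) by blast
qed

text \<open>The annihilator in \<Gamma> of a nonzero \<open>v\<close> is a proper ideal containing
  the maximal ideal \<open>m\<close>.\<close>

lemma weight_vector_annihilator:
  assumes "weight_vector E v" "v \<noteq> \<zero>" "g \<in> Gamma W" "Gamma_emb g \<odot> v = \<zero>"
  shows "g \<in> m"
proof (rule ccontr)
  assume "g \<notin> m"
  then obtain h where h: "h \<in> Gamma W" "1 - h * g \<in> m"
    using m_inverse[OF assms(3)] by blast
  have v: "v \<in> carrier E" "Gamma_emb (1 - h * g) \<odot> v = \<zero>"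
    using assms(1) h(2) by (auto simp: weight_vector_def)
  have "v = Gamma_emb (h * g + (1 - h * g)) \<odot> v"
    using Gamma_emb_one[OF v(1)] by simp
  also have "\<dots> = Gamma_emb (h * g) \<odot> v \<oplus> Gamma_emb (1 - h * g) \<odot> v"
    using h m_D(1) by (intro Gamma_emb_hom(1) Gamma_closed(4) assms(3) v(1)) auto
  also have "Gamma_emb (h * g) \<odot> v = \<zero>"
    using Gamma_emb_hom(2)[OF h(1) assms(3) v(1)] assms(4) act_zero_right[OF Gamma_emb_U[OF h(1)]]
    by simp
  finally show False
    using v(2) assms(2) by simp
qed

section \<open>Dimension over the base field\<close>

lemma k_space_simps:
  "carrier (k_space scale E) = carrier E" "add (k_space scale E) = add E"
  "ring.zero (k_space scale E) = \<zero>"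
  "c \<odot>\<^bsub>k_space scale E\<^esub> x = k_emb scale c \<odot> x"
  by (simp_all add: k_space_def with_scalars_def)

lemma k_emb_hom:
  assumes "x \<in> carrier E"
  shows "k_emb scale (a + b) \<odot> x = k_emb scale a \<odot> x \<oplus> k_emb scale b \<odot> x"
    and "k_emb scale (a * b) \<odot> x = k_emb scale a \<odot> (k_emb scale b \<odot> x)"
  using Gamma_emb_hom[OF Gamma_closed(7)[OF Gamma_closed(2)] Gamma_closed(7)[OF Gamma_closed(2)] assms, of a b]
  by (simp_all add: k_emb_def scale_left_distrib scale_one_mult)

lemma left_module_k_space: "left_module (ring_of_type_algebra :: 'k ring) (k_space scale E)"
proof (intro left_module.intro left_module_axioms.intro)
  show "ring (ring_of_type_algebra :: 'k ring)"
    by (rule ring_from_type_algebra)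
  show "abelian_group (k_space scale E)"
  proof (rule abelian_groupI)
    show "\<exists>y\<in>carrier (k_space scale E). y \<oplus>\<^bsub>k_space scale E\<^esub> x = \<zero>\<^bsub>k_space scale E\<^esub>"
      if "x \<in> carrier (k_space scale E)" for x
      using that E.E.l_neg[of x] E.E.a_inv_closed[of x] by (auto simp: k_space_simps)
  qed (simp_all add: k_space_simps E.E.a_ac)
qed (auto simp: k_space_simps k_emb_hom act_closed k_emb_U act_add_right ring_of_type_algebra_def
    k_emb_def[of scale 1] Gamma_emb_one)

lemma submodule_weight_space:
  "submodule (weight_space W E m) (ring_of_type_algebra :: 'k ring) (k_space scale E)"
proof (rule left_module.submodule_if_closed[OF left_module_k_space])
  show "weight_space W E m \<subseteq> carrier (k_space scale E)"
    by (auto simp: weight_space_def k_space_simps)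
qed (simp_all add: k_space_simps weight_space_add weight_space_zero weight_space_k_emb)

text \<open>Links the two notions of span: \<open>skew.span_minimal\<close>, applied to this
  preimage, bounds the image of a span in \<open>U\<close> by a submodule of the record
  \<open>k_space scale E\<close>.\<close>

lemma subspace_submodule_preimage:
  assumes "submodule N (ring_of_type_algebra :: 'k ring) (k_space scale E)" "x \<in> carrier E"
  shows "skew.subspace {u \<in> U. u \<odot> x \<in> N}"
proof (rule skew.subspaceI)
  interpret N: submodule N "ring_of_type_algebra :: 'k ring" "k_space scale E"
    by fact
  show "0 \<in> {u \<in> U. u \<odot> x \<in> N}"
    using N.one_closed act_zero_left[OF assms(2)] U_closed(2) by (simp add: k_space_simps)
  show "u + v \<in> {u \<in> U. u \<odot> x \<in> N}" if "u \<in> {u \<in> U. u \<odot> x \<in> N}" "v \<in> {u \<in> U. u \<odot> x \<in> N}" for u v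
    using that N.m_closed[of "u \<odot> x" "v \<odot> x"] U_closed(1)[of u v] act_add_left[of u v x] assms(2)
    by (simp add: k_space_simps)
  show "kscale c u \<in> {u \<in> U. u \<odot> x \<in> N}" if "u \<in> {u \<in> U. u \<odot> x \<in> N}" for c u
    using that N.smult_closed[of c "u \<odot> x"] kscale_U[of u c] act_kscale(1)[of u x c] assms(2)
    by (simp add: k_space_simps ring_of_type_algebra_def)
qed

text \<open>By irreducibility an element of the weight space is \<open>u v\<close> with
  \<open>u\<close> in \<open>U\<close>. Twisting moves \<open>u\<close> into \<open>U0\<close> at
  the cost of a factor that is invertible on the weight space, and \<open>span\<close> replaces the
  result by an element of \<open>skew.span T\<close>.\<close>

lemma finite_dim_weight_space:
  assumes irr: "irreducible_module (U_ring M U) E" and v: "weight_vector E v" "v \<noteq> \<zero>"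
    and T: "finite T" "T \<subseteq> U"
    and span: "\<And>u. u \<in> U0 \<Longrightarrow> \<exists>u'\<in>skew.span T. u \<odot> v = u' \<odot> v"
  shows "finite_dim_k scale E (weight_space W E m)"
proof -
  let ?Z = "weight_space W E m" and ?R = "ring_of_type_algebra :: 'k ring"
  have vE: "v \<in> carrier E"
    using v(1) by (simp add: weight_vector_def)
  have TU: "skew.span T \<subseteq> U"
    using T(2) subspace_U by (rule skew.span_minimal)
  have repr: "\<exists>u\<in>skew.span T. z = u \<odot> v" if z: "z \<in> ?Z" for z
  proof -
    have "z \<in> carrier E"
      using z by (simp add: weight_space_def)
    then obtain u where u: "u \<in> U" "z = u \<odot> v"
      using E.irreducible_generated[OF irr vE v(2)] by (auto simp: U_ring_simps)
    obtain p \<gamma> where p: "\<gamma> \<in> m" "\<And>i. coeff p i \<in> Gamma W" "coeff p 0 \<notin> m" "twist p \<gamma> u \<in> U0"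
      by (rule exists_twist[OF u(1)]) blast
    obtain h where h: "h \<in> Gamma W" "Gamma_emb h \<odot> (Gamma_emb (coeff p 0) \<odot> z) = z"
      using weight_space_unit[OF z p(2,3)] by blast
    \<comment> \<open>Left multiplication by \<open>h\<close> undoes the factor
      \<open>coeff p 0\<close> on \<open>z\<close> and does not enlarge the support.\<close>
    let ?u = "Gamma_emb h \<otimes>\<^bsub>skew_ring M\<^esub> twist p \<gamma> u"
    have tU: "twist p \<gamma> u \<in> U"
      using p(4) by (simp add: U0_def)
    have "supp ?u \<subseteq> supp (twist p \<gamma> u)"
      unfolding Gamma_mult_left[OF tU] by (auto simp: supp_def)
    then have "?u \<in> U0"
      using p(4) U_closed(4)[OF Gamma_emb_U[OF h(1)] tU] by (auto simp: U0_def)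
    moreover have "?u \<odot> v = z"
      unfolding act_mult[OF Gamma_emb_U[OF h(1)] tU vE] act_twist[OF u(1) p(1,2) v(1)]
      using h(2) u(2) by simp
    ultimately show ?thesis
      using span by metis
  qed
  \<comment> \<open>The vectors \<open>t v\<close> with \<open>t\<close> in \<open>T\<close> need
    not lie in the weight space, so generators are taken from those elements of
    \<open>skew.span T\<close> that map \<open>v\<close> into it.\<close>
  define D where "D = {u \<in> U. u \<odot> v \<in> ?Z} \<inter> skew.span T"
  obtain B where B: "B \<subseteq> D" "skew.independent B" "D \<subseteq> skew.span B"
    by (rule skew.maximal_independent_subset)
  have fB: "finite B"
    using skew.independent_span_bound[OF T(1) B(2)] B(1) by (auto simp: D_def)
  let ?S = "(\<lambda>u. u \<odot> v) ` B"
  have "?Z = mod_span ?R (k_space scale E) ?S"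
  proof
    show "mod_span ?R (k_space scale E) ?S \<subseteq> ?Z"
      using submodule_weight_space B(1) by (auto simp: mod_span_def D_def)
    show "?Z \<subseteq> mod_span ?R (k_space scale E) ?S"
    proof
      fix z assume z: "z \<in> ?Z"
      obtain u where u: "u \<in> skew.span T" "z = u \<odot> v"
        using repr[OF z] by blast
      then have uB: "u \<in> skew.span B"
        using z B(3) TU by (auto simp: D_def)
      have "z \<in> N" if N: "submodule N ?R (k_space scale E)" "?S \<subseteq> N" for N
      proof -
        have "skew.span B \<subseteq> {u \<in> U. u \<odot> v \<in> N}"
          using N(2) B(1) by (intro skew.span_minimal subspace_submodule_preimage N(1) vE) (auto simp: D_def)
        then show ?thesis
          using uB u(2) by blast
      qed
      then show "z \<in> mod_span ?R (k_space scale E) ?S"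
        by (auto simp: mod_span_def)
    qed
  qed
  moreover have "?S \<subseteq> carrier (k_space scale E)"
    using B(1) vE by (auto simp: D_def k_space_simps act_closed)
  ultimately show ?thesis
    unfolding finite_dim_k_def fin_gen_def using fB by blast
qed

text \<open>As \<open>m\<close> is the annihilator of \<open>v\<close>, the space of all
  \<open>\<gamma> v\<close> is a copy of \<Gamma> modulo \<open>m\<close>. Its finite dimension,
  given by local finiteness, lifts to finitely many elements of \<Gamma>.\<close>

lemma Gamma_spanned_modulo_m:
  assumes v: "weight_vector E v" "v \<noteq> \<zero>"
    and fd: "finite_dim_k scale E ((\<lambda>\<gamma>. Gamma_emb \<gamma> \<odot> v) ` Gamma W)"
  obtains G where "finite G" "span G \<subseteq> Gamma W" "\<And>\<gamma>. \<gamma> \<in> Gamma W \<Longrightarrow> \<exists>\<beta>\<in>span G. \<gamma> - \<beta> \<in> m"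
proof -
  let ?R = "ring_of_type_algebra :: 'k ring" and ?f = "\<lambda>\<gamma>. Gamma_emb \<gamma> \<odot> v"
  have vE: "v \<in> carrier E"
    using v(1) by (simp add: weight_vector_def)
  obtain S where S: "finite S" "?f ` Gamma W = mod_span ?R (k_space scale E) S"
    using fd by (auto simp: finite_dim_k_def fin_gen_def)
  then have "S \<subseteq> ?f ` Gamma W"
    by (auto simp: mod_span_def)
  then obtain G where G: "G \<subseteq> Gamma W" "finite G" "S = ?f ` G"
    using finite_subset_image[OF S(1)] by metis
  have sub: "span G \<subseteq> Gamma W"
    using G(1) by (intro span_minimal subspaceI) (auto simp: Gamma_closed)
  have "submodule (?f ` span G) ?R (k_space scale E)"
  proof (rule left_module.submodule_if_closed[OF left_module_k_space])
    show "?f ` span G \<subseteq> carrier (k_space scale E)"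
      using sub vE by (auto simp: k_space_simps act_closed Gamma_emb_U)
    have "?f 0 = \<zero>"
      using act_zero_left[OF vE] by (simp add: Gamma_emb_def coeff_emb_def zero_fun_def)
    then show "\<zero>\<^bsub>k_space scale E\<^esub> \<in> ?f ` span G"
      using span_zero[of G] unfolding k_space_simps by (metis image_eqI)
  next
    fix x y assume "x \<in> ?f ` span G" "y \<in> ?f ` span G"
    then obtain a b where ab: "a \<in> span G" "b \<in> span G" "x = ?f a" "y = ?f b"
      by blast
    then have "a \<in> Gamma W" "b \<in> Gamma W"
      using sub by blast+
    then have "x \<oplus> y = ?f (a + b)"
      using Gamma_emb_hom(1)[of a b v] vE ab(3,4) by simp
    then show "x \<oplus>\<^bsub>k_space scale E\<^esub> y \<in> ?f ` span G"
      using span_add[OF ab(1,2)] by (simp add: k_space_simps)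
  next
    fix c x assume "x \<in> ?f ` span G"
    then obtain a where a: "a \<in> span G" "x = ?f a"
      by blast
    then have "k_emb scale c \<odot> x = ?f (scale c 1 * a)"
      using Gamma_emb_hom(2)[of "scale c 1" a v] sub vE Gamma_closed(2,7) by (auto simp: k_emb_def)
    also have "scale c 1 * a = scale c a"
      by (simp flip: scale_mult_left)
    finally show "c \<odot>\<^bsub>k_space scale E\<^esub> x \<in> ?f ` span G"
      using span_scale[OF a(1)] by (simp add: k_space_simps)
  qed
  moreover have "S \<subseteq> ?f ` span G"
    using G(3) span_superset[of G] by auto
  ultimately have "?f ` Gamma W \<subseteq> ?f ` span G"
    unfolding S(2) by (auto simp: mod_span_def)
  have "\<exists>\<beta>\<in>span G. \<gamma> - \<beta> \<in> m" if \<gamma>: "\<gamma> \<in> Gamma W" for \<gamma>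
  proof -
    obtain \<beta> where \<beta>: "\<beta> \<in> span G" "?f \<gamma> = ?f \<beta>"
      using \<open>?f ` Gamma W \<subseteq> ?f ` span G\<close> \<gamma> by blast
    have \<beta>G: "\<beta> \<in> Gamma W"
      using \<beta>(1) sub by blast
    have d: "\<gamma> - \<beta> \<in> Gamma W"
      using Gamma_closed(6)[OF \<gamma> \<beta>G] .
    have "?f \<gamma> = ?f ((\<gamma> - \<beta>) + \<beta>)"
      by simp
    also have "\<dots> = ?f (\<gamma> - \<beta>) \<oplus> ?f \<beta>"
      by (rule Gamma_emb_hom(1)[OF d \<beta>G vE])
    finally have "?f (\<gamma> - \<beta>) = \<zero>"
      using \<beta>(2) act_closed[OF Gamma_emb_U[OF d] vE] act_closed[OF Gamma_emb_U[OF \<beta>G] vE]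
      by (metis E.E.add.r_cancel_one')
    then have "\<gamma> - \<beta> \<in> m"
      by (rule weight_vector_annihilator[OF v d])
    then show ?thesis
      using \<beta>(1) by blast
  qed
  then show thesis
    using that[OF G(2) sub] by blast
qed

end

end

section \<open>Irreducible modules\<close>

context galois_order_at
begin

section \<open>The residue field of \<open>m\<close>\<close>

lemma residue_field_algebraic:
  assumes G: "finite G" "span G \<subseteq> Gamma W" and mod: "\<And>\<gamma>. \<gamma> \<in> Gamma W \<Longrightarrow> \<exists>\<beta>\<in>span G. \<gamma> - \<beta> \<in> m"
    and \<gamma>: "\<gamma> \<in> Gamma W"
  shows "\<exists>p. p \<noteq> 0 \<and> poly (map_poly (\<lambda>c. scale c 1) p) \<gamma> \<in> m"
proof -
  let ?ev = "\<lambda>p. poly (map_poly (\<lambda>c. scale c 1) p) \<gamma>"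
  have ev_add: "?ev (p + q) = ?ev p + ?ev q" for p q
    by (simp add: map_poly_hom(1) scale_left_distrib)
  have ev_monom: "?ev (monom c n) = scale c (\<gamma> ^ n)" for c n
    by (simp add: map_poly_monom poly_monom flip: scale_mult_left)
  have ev_sum: "?ev (sum f A) = (\<Sum>a\<in>A. ?ev (f a))" for f and A :: "nat set"
    by (induction A rule: infinite_finite_induct) (simp_all add: ev_add)
  have pow: "\<gamma> ^ n \<in> Gamma W" for n
    by (induction n) (simp_all add: Gamma_closed \<gamma>)
  then have "\<forall>n. \<exists>\<beta>. \<beta> \<in> span G \<and> \<gamma> ^ n - \<beta> \<in> m"
    using mod by blast
  then obtain \<beta> where \<beta>: "\<And>n. \<beta> n \<in> span G" "\<And>n. \<gamma> ^ n - \<beta> n \<in> m"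
    by metis
  \<comment> \<open>There are \<open>card G + 1\<close> exponents in \<open>?I\<close>, and the
    corresponding powers are congruent modulo \<open>m\<close> to vectors in the span of
    \<open>card G\<close> elements, so a linear relation must exist.\<close>
  let ?I = "{..card G}"
  have relation: "\<exists>p. p \<noteq> 0 \<and> ?ev p \<in> m"
    if c: "c i \<noteq> 0" "i \<le> card G" "(\<Sum>n\<in>?I. scale (c n) (\<beta> n)) = 0" for c i
  proof -
    define p where "p = (\<Sum>n\<in>?I. monom (c n) n)"
    have "coeff p i = c i"
      using c(2) by (simp add: p_def coeff_sum sum.delta)
    then have "p \<noteq> 0"
      using c(1) by auto
    have "?ev p = (\<Sum>n\<in>?I. scale (c n) (\<gamma> ^ n)) - (\<Sum>n\<in>?I. scale (c n) (\<beta> n))"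
      using c(3) by (simp add: p_def ev_sum ev_monom)
    also have "\<dots> = (\<Sum>n\<in>?I. scale (c n) (\<gamma> ^ n - \<beta> n))"
      by (simp add: sum_subtractf scale_right_diff_distrib)
    also have "\<dots> \<in> m"
    proof -
      have mem: "scale (c n) (\<gamma> ^ n - \<beta> n) \<in> m" for n
        using m_D(5)[OF \<beta>(2), of "scale (c n) 1" n] Gamma_closed(2,7) by (simp flip: scale_mult_left)
      have "(\<Sum>n\<in>A. scale (c n) (\<gamma> ^ n - \<beta> n)) \<in> m" for A
        using m_D(2,3) mem by (induction A rule: infinite_finite_induct) simp_all
      then show ?thesis .
    qed
    finally show ?thesis
      using \<open>p \<noteq> 0\<close> by blast
  qed
  show ?thesis
  \<comment> \<open>Dependence is a property of the set of the \<open>\<beta> n\<close>, so a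
    repeated vector is treated separately; it yields the polynomial \<open>X^i - X^j\<close> up to
    sign.\<close>
  proof (cases "inj_on \<beta> ?I")
    case False
    then obtain i j where ij: "i \<le> card G" "j \<le> card G" "i \<noteq> j" "\<beta> i = \<beta> j"
      by (auto simp: inj_on_def)
    define c :: "nat \<Rightarrow> 'k" where "c n = (if n = i then 1 else if n = j then - 1 else 0)" for n
    have "(\<Sum>n\<in>?I. scale (c n) (\<beta> n)) = (\<Sum>n\<in>{i, j}. scale (c n) (\<beta> n))"
      using ij by (intro sum.mono_neutral_right) (auto simp: c_def)
    also have "\<dots> = 0"
      using ij by (simp add: c_def)
    finally show ?thesis
      using relation[of c i] ij(1) by (simp add: c_def)
  next
    case True
    have "\<not> independent (\<beta> ` ?I)"
    proof
      assume "independent (\<beta> ` ?I)"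
      then have "card (\<beta> ` ?I) \<le> card G"
        using independent_span_bound[OF G(1)] \<beta>(1) by blast
      then show False
        using card_image[OF True] by simp
    qed
    then obtain u b where u: "b \<in> \<beta> ` ?I" "u b \<noteq> 0" "(\<Sum>v\<in>\<beta> ` ?I. scale (u v) v) = 0"
      using dependent_finite[of "\<beta> ` ?I"] by auto
    then obtain i where i: "i \<le> card G" "b = \<beta> i"
      by auto
    have "(\<Sum>n\<in>?I. scale (u (\<beta> n)) (\<beta> n)) = 0"
      using u(3) by (simp add: sum.reindex[OF True])
    then show ?thesis
      using relation[of "\<lambda>n. u (\<beta> n)" i] i u(2) by simp
  qed
qed

text \<open>Over an algebraically closed field \<open>p\<close> is a product of linear factors and a
  nonzero constant. As \<open>m\<close> is prime, one of the factors takes a value in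
  \<open>m\<close> at \<open>\<gamma>\<close>, and the constant cannot, being a unit.\<close>

lemma residue_field_trivial:
  assumes "\<gamma> \<in> Gamma W" "p \<noteq> 0" "poly (map_poly (\<lambda>c. scale c 1) p) \<gamma> \<in> m"
  shows "\<exists>c. \<gamma> - scale c 1 \<in> m"
  using assms(2,3)
proof (induction "degree p" arbitrary: p rule: less_induct)
  case less
  let ?ev = "\<lambda>p. poly (map_poly (\<lambda>c. scale c 1) p) \<gamma>"
  show ?case
  proof (cases "degree p = 0")
    case True
    then obtain c where c: "p = [:c:]"
      by (rule degree_eq_zeroE)
    then have "c \<noteq> 0" "scale c 1 \<in> m"
      using less.prems by (simp_all add: map_poly_pCons)
    then have "scale (inverse c) 1 * scale c 1 \<in> m"
      using m_D(5) Gamma_closed(2,7) by blast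
    moreover have "scale (inverse c) 1 * scale c 1 = 1"
      using \<open>c \<noteq> 0\<close> by (simp flip: scale_one_mult)
    ultimately show ?thesis
      using one_notin_m by simp
  next
    case False
    then obtain c where "poly p c = 0"
      using alg_closed_imp_poly_has_root[of p] by auto
    then obtain q where q: "p = [:- c, 1:] * q"
      by (auto simp: poly_eq_0_iff_dvd elim: dvdE)
    have q0: "q \<noteq> 0"
      using less.prems(1) q by auto
    then have deg: "degree q < degree p"
      unfolding q by (subst degree_mult_eq) auto
    have map_p: "map_poly (\<lambda>c. scale c 1) p = map_poly (\<lambda>c. scale c 1) [:- c, 1:] * map_poly (\<lambda>c. scale c 1) q"
      unfolding q by (rule map_poly_hom(2)) (simp_all add: scale_left_distrib scale_one_mult)
    have "poly (map_poly (\<lambda>c. scale c 1) [:- c, 1:]) \<gamma> = \<gamma> - scale c 1"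
      by (simp add: map_poly_pCons)
    then have ev: "?ev p = (\<gamma> - scale c 1) * ?ev q"
      unfolding map_p poly_mult by simp
    have "?ev q \<in> Gamma W"
    proof (induction q)
      case (pCons a q)
      then show ?case
        using assms(1) by (simp add: map_poly_pCons Gamma_closed)
    qed (simp add: Gamma_closed)
    then have "\<gamma> - scale c 1 \<in> m \<or> ?ev q \<in> m"
      using less.prems(2) ev m_prime assms(1) Gamma_closed(2,6,7) by metis
    then show ?thesis
      using less.hyps[OF deg q0] by blast
  qed
qed

text \<open>If \<open>a - c\<close> lies in \<open>m\<close> for a scalar \<open>c\<close>, then
  \<open>x a\<close> acts on weight vectors as \<open>c x\<close>. Hence the elements of
  \<open>U\<close> that act on weight vectors like an element of \<open>skew.span T\<close> form a
  right \<Gamma>-submodule, which contains \<open>T\<close>. The element \<open>u'\<close> is chosen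
  before the module and the vector; the counting argument depends on this.\<close>

lemma U0_span:
  fixes T :: "'a skew set"
  assumes residue: "\<And>\<gamma>. \<gamma> \<in> Gamma W \<Longrightarrow> \<exists>c. \<gamma> - scale c 1 \<in> m"
    and T: "T \<subseteq> U" "U0 \<subseteq> mod_span (Gamma_ring W) (right_KK M W Gamma_emb) T"
    and u: "u \<in> U0"
  shows "\<exists>u'\<in>skew.span T. \<forall>(E :: ('a skew, 'm, 'q) module_scheme) v.
    weight_vector E v \<longrightarrow> u \<odot>\<^bsub>E\<^esub> v = u' \<odot>\<^bsub>E\<^esub> v"
proof -
  define agree where "agree u u' \<longleftrightarrow> (\<forall>(E :: ('a skew, 'm, 'q) module_scheme) v.
    weight_vector E v \<longrightarrow> u \<odot>\<^bsub>E\<^esub> v = u' \<odot>\<^bsub>E\<^esub> v)" for u u'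
  have wv: "left_module (U_ring M U) E" "v \<in> carrier E"
    "\<And>a. a \<in> m \<Longrightarrow> Gamma_emb a \<odot>\<^bsub>E\<^esub> v = \<zero>\<^bsub>E\<^esub>"
    if "weight_vector E v" for E :: "('a skew, 'm, 'q) module_scheme" and v
    using that by (auto simp: weight_vector_def)
  have TU: "skew.span T \<subseteq> U"
    using T(1) subspace_U by (rule skew.span_minimal)
  have agree_kscale: "agree (kscale c u) (kscale c u')" if "agree u u'" "u \<in> U" "u' \<in> U" for c u u'
    using that act_kscale(1)[OF wv(1)] wv(2) unfolding agree_def by metis
  define N where "N = {u \<in> U. \<exists>u'\<in>skew.span T. agree u u'}"
  have "submodule N (Gamma_ring W) (right_KK M W Gamma_emb)"
  proof (intro submodule.intro submodule_axioms.intro additive_subgroupI)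
    show "N \<subseteq> carrier (right_KK M W Gamma_emb)"
      using U_KK by (auto simp: N_def)
    show "0 \<in> N"
      using U_closed(2) skew.span_zero by (auto simp: N_def agree_def)
    show "x + y \<in> N" if xy: "x \<in> N" "y \<in> N" for x y
    proof -
      obtain x' y' where x': "x' \<in> skew.span T" "agree x x'" and y': "y' \<in> skew.span T" "agree y y'"
        using xy by (auto simp: N_def)
      have U: "x \<in> U" "y \<in> U" "x' \<in> U" "y' \<in> U"
        using xy x' y' TU by (auto simp: N_def)
      have "agree (x + y) (x' + y')"
        unfolding agree_def
      proof (intro allI impI)
        fix E :: "('a skew, 'm, 'q) module_scheme" and v
        assume "weight_vector E v"
        then show "(x + y) \<odot>\<^bsub>E\<^esub> v = (x' + y') \<odot>\<^bsub>E\<^esub> v"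
          using act_add_left[OF wv(1) U(1,2) wv(2)] act_add_left[OF wv(1) U(3,4) wv(2)] x'(2) y'(2)
          by (simp add: agree_def)
      qed
      then show ?thesis
        using U_closed(1)[OF U(1,2)] skew.span_add[OF x'(1) y'(1)] by (auto simp: N_def)
    qed
    have kscale: "kscale c x \<in> N" if x: "x \<in> N" for c x
    proof -
      obtain x' where x': "x' \<in> skew.span T" "agree x x'"
        using x by (auto simp: N_def)
      have "x \<in> U" "x' \<in> U"
        using x x' TU by (auto simp: N_def)
      then show ?thesis
        using agree_kscale[OF x'(2), of c] kscale_U[of x c] skew.span_scale[OF x'(1), of c]
        unfolding N_def by blast
    qed
    show "- x \<in> N" if "x \<in> N" for x
      using kscale[OF that, of "- 1"] by (simp add: kscale_minus_one)
    show "a \<odot>\<^bsub>right_KK M W Gamma_emb\<^esub> x \<in> N" if a: "a \<in> carrier (Gamma_ring W)" and x: "x \<in> N" for a x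
    proof -
      have aG: "a \<in> Gamma W" and xU: "x \<in> U"
        using a x by (simp_all add: Gamma_ring_def N_def)
      obtain c where c: "a - scale c 1 \<in> m"
        using residue[OF aG] by blast
      have cG: "a - scale c 1 \<in> Gamma W" "scale c 1 \<in> Gamma W"
        using c m_D(1) Gamma_closed(2,7) by auto
      have xa: "x \<otimes>\<^bsub>skew_ring M\<^esub> Gamma_emb a \<in> U"
        using U_closed(4)[OF xU Gamma_emb_U[OF aG]] .
      have "(x \<otimes>\<^bsub>skew_ring M\<^esub> Gamma_emb a) \<odot>\<^bsub>E\<^esub> v = kscale c x \<odot>\<^bsub>E\<^esub> v"
        if v: "weight_vector E v" for E :: "('a skew, 'm, 'q) module_scheme" and v
      proof -
        interpret E: left_module "U_ring M U" E
          by (rule wv(1)[OF v])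
        have "Gamma_emb a \<odot>\<^bsub>E\<^esub> v = Gamma_emb ((a - scale c 1) + scale c 1) \<odot>\<^bsub>E\<^esub> v"
          by simp
        also have "\<dots> = Gamma_emb (a - scale c 1) \<odot>\<^bsub>E\<^esub> v \<oplus>\<^bsub>E\<^esub> Gamma_emb (scale c 1) \<odot>\<^bsub>E\<^esub> v"
          by (rule Gamma_emb_hom(1)[OF wv(1)[OF v] cG wv(2)[OF v]])
        also have "\<dots> = k_emb scale c \<odot>\<^bsub>E\<^esub> v"
          using wv(3)[OF v c] act_closed[OF wv(1)[OF v] k_emb_U wv(2)[OF v]] by (simp add: k_emb_def)
        finally show ?thesis
          using act_mult[OF wv(1)[OF v] xU Gamma_emb_U[OF aG] wv(2)[OF v]]
            act_kscale[OF wv(1)[OF v] xU wv(2)[OF v], of c] by simp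
      qed
      then have "agree (x \<otimes>\<^bsub>skew_ring M\<^esub> Gamma_emb a) (kscale c x)"
        by (simp add: agree_def)
      then show ?thesis
        using kscale[OF x, of c] xa by (auto simp: N_def agree_def)
    qed
  qed simp_all
  moreover have "T \<subseteq> N"
    using T(1) skew.span_superset by (auto simp: N_def agree_def)
  ultimately have "U0 \<subseteq> N"
    using T(2) by (auto simp: mod_span_def)
  then show ?thesis
    using u by (auto simp: N_def agree_def)
qed

text \<open>For each \<open>E\<close>, separation gives an element fixing \<open>v E\<close> and
  annihilating the other chosen vectors; twisting and \<open>span\<close> turn it into
  \<open>q E\<close> in \<open>skew.span T\<close> with the same pattern of vanishing. This pattern
  makes the \<open>q E\<close> distinct and linearly independent.\<close>

lemma card_nonisomorphic_irreducibles:
  fixes J :: "('a skew, 'm, 'q) module_scheme set"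
  assumes T: "finite T" "T \<subseteq> U"
    and span: "\<And>u. u \<in> U0 \<Longrightarrow> \<exists>u'\<in>skew.span T. \<forall>(E :: ('a skew, 'm, 'q) module_scheme) v.
      weight_vector E v \<longrightarrow> u \<odot>\<^bsub>E\<^esub> v = u' \<odot>\<^bsub>E\<^esub> v"
    and J: "finite J" "\<And>E. E \<in> J \<Longrightarrow> irreducible_module (U_ring M U) E"
      "\<And>E. E \<in> J \<Longrightarrow> \<exists>v. weight_vector E v \<and> v \<noteq> \<zero>\<^bsub>E\<^esub>"
    and noniso: "\<And>E F. E \<in> J \<Longrightarrow> F \<in> J \<Longrightarrow> E \<noteq> F \<Longrightarrow> \<not> module_isomorphic (U_ring M U) E F"
  shows "card J \<le> card T"
proof -
  obtain v where v: "\<And>E. E \<in> J \<Longrightarrow> weight_vector E (v E) \<and> v E \<noteq> \<zero>\<^bsub>E\<^esub>"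
    using J(3) by metis
  have vE: "left_module (U_ring M U) E" "v E \<in> carrier E" if "E \<in> J" for E
    using v[OF that] by (auto simp: weight_vector_def)
  have TU: "skew.span T \<subseteq> U"
    using T(2) subspace_U by (rule skew.span_minimal)
  have "\<exists>q\<in>skew.span T. q \<odot>\<^bsub>E\<^esub> v E \<noteq> \<zero>\<^bsub>E\<^esub> \<and> (\<forall>F\<in>J - {E}. q \<odot>\<^bsub>F\<^esub> v F = \<zero>\<^bsub>F\<^esub>)" if E: "E \<in> J" for E
  proof -
    have "(\<lambda>r. r \<odot>\<^bsub>E\<^esub> v E) ` {r \<in> carrier (U_ring M U). \<forall>F\<in>J - {E}. r \<odot>\<^bsub>F\<^esub> v F = \<zero>\<^bsub>F\<^esub>} = carrier E"
      by (rule nonisomorphic_irreducible_separation) (use E J vE v noniso in auto)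
    then obtain e where e: "e \<in> U" "e \<odot>\<^bsub>E\<^esub> v E = v E" "\<And>F. F \<in> J - {E} \<Longrightarrow> e \<odot>\<^bsub>F\<^esub> v F = \<zero>\<^bsub>F\<^esub>"
      using vE(2)[OF E] unfolding U_ring_simps by (smt (verit) imageE mem_Collect_eq)
    obtain p \<gamma> where p: "\<gamma> \<in> m" "\<And>i. coeff p i \<in> Gamma W" "coeff p 0 \<notin> m" "twist p \<gamma> e \<in> U0"
      by (rule exists_twist[OF e(1)]) blast
    obtain q where q: "q \<in> skew.span T"
      "\<And>(F :: ('a skew, 'm, 'q) module_scheme) x. weight_vector F x \<Longrightarrow> twist p \<gamma> e \<odot>\<^bsub>F\<^esub> x = q \<odot>\<^bsub>F\<^esub> x"
      using span[OF p(4)] by blast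
    have act: "q \<odot>\<^bsub>F\<^esub> v F = Gamma_emb (coeff p 0) \<odot>\<^bsub>F\<^esub> (e \<odot>\<^bsub>F\<^esub> v F)" if "F \<in> J" for F
      using q(2) act_twist[OF vE(1)[OF that] e(1) p(1,2)] v[OF that] by metis
    have "q \<odot>\<^bsub>F\<^esub> v F = \<zero>\<^bsub>F\<^esub>" if "F \<in> J - {E}" for F
      using act[of F] e(3)[OF that] that act_zero_right[OF vE(1) Gamma_emb_U[OF p(2)], of F 0] by simp
    \<comment> \<open>The factor \<open>coeff p 0\<close> lies outside \<open>m\<close>, which is
      the annihilator of \<open>v E\<close> in \<Gamma>.\<close>
    moreover have "q \<odot>\<^bsub>E\<^esub> v E \<noteq> \<zero>\<^bsub>E\<^esub>"
      using act[OF E] e(2) weight_vector_annihilator[OF vE(1)[OF E], of "v E" "coeff p 0"] v[OF E] p(2,3)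
      by auto
    ultimately show ?thesis
      using q(1) by blast
  qed
  then obtain q where q: "\<And>E. E \<in> J \<Longrightarrow> q E \<in> skew.span T" "\<And>E. E \<in> J \<Longrightarrow> q E \<odot>\<^bsub>E\<^esub> v E \<noteq> \<zero>\<^bsub>E\<^esub>"
    "\<And>E F. E \<in> J \<Longrightarrow> F \<in> J \<Longrightarrow> F \<noteq> E \<Longrightarrow> q E \<odot>\<^bsub>F\<^esub> v F = \<zero>\<^bsub>F\<^esub>"
    by (metis DiffI singletonD)
  have inj: "inj_on q J"
    using q(2,3) by (metis inj_onI)
  have "skew.independent (q ` J)"
  proof
    assume "skew.dependent (q ` J)"
    then obtain E where E: "E \<in> J" "q E \<in> skew.span (q ` J - {q E})"
      by (auto simp: skew.dependent_def)
    \<comment> \<open>This subspace contains all the other \<open>q F\<close> but not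
      \<open>q E\<close>.\<close>
    have "skew.subspace {u \<in> U. u \<odot>\<^bsub>E\<^esub> v E = \<zero>\<^bsub>E\<^esub>}"
    proof (rule skew.subspaceI)
      interpret E: left_module "U_ring M U" E
        by (rule vE(1)[OF E(1)])
      note lm = vE(1)[OF E(1)] and car = vE(2)[OF E(1)]
      show "0 \<in> {u \<in> U. u \<odot>\<^bsub>E\<^esub> v E = \<zero>\<^bsub>E\<^esub>}"
        using act_zero_left[OF lm car] U_closed(2) by simp
      show "x + y \<in> {u \<in> U. u \<odot>\<^bsub>E\<^esub> v E = \<zero>\<^bsub>E\<^esub>}"
        if "x \<in> {u \<in> U. u \<odot>\<^bsub>E\<^esub> v E = \<zero>\<^bsub>E\<^esub>}" "y \<in> {u \<in> U. u \<odot>\<^bsub>E\<^esub> v E = \<zero>\<^bsub>E\<^esub>}" for x y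
        using that act_add_left[OF lm _ _ car, of x y] U_closed(1) by simp
      show "kscale c x \<in> {u \<in> U. u \<odot>\<^bsub>E\<^esub> v E = \<zero>\<^bsub>E\<^esub>}"
        if "x \<in> {u \<in> U. u \<odot>\<^bsub>E\<^esub> v E = \<zero>\<^bsub>E\<^esub>}" for c x
        using that act_kscale(1)[OF lm _ car, of x c] kscale_U act_zero_right[OF lm k_emb_U] by simp
    qed
    moreover have "q ` J - {q E} \<subseteq> {u \<in> U. u \<odot>\<^bsub>E\<^esub> v E = \<zero>\<^bsub>E\<^esub>}"
      using q(1,3) E(1) TU by auto
    ultimately have "skew.span (q ` J - {q E}) \<subseteq> {u \<in> U. u \<odot>\<^bsub>E\<^esub> v E = \<zero>\<^bsub>E\<^esub>}"
      by (intro skew.span_minimal)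
    then show False
      using E q(2) by blast
  qed
  then have "card (q ` J) \<le> card T"
    using skew.independent_span_bound[OF T(1)] q(1) by blast
  then show ?thesis
    by (simp add: card_image[OF inj])
qed

text \<open>A single module suffices to determine the residue field, and the finite set
  \<open>T\<close> is then the same for all modules. Every finite set of isomorphism classes has at
  most \<open>card T\<close> members, so there are finitely many classes.\<close>

lemma finite_Irred_and_weight_space:
  "finite (Irred scale M W U m :: ('a skew, 'm) module set set) \<and>
    (\<forall>C \<in> (Irred scale M W U m :: ('a skew, 'm) module set set). \<forall>E \<in> C.
       finite_dim_k scale E (weight_space W E m))"
proof -
  define A where "A = (irred_HC_modules scale M W U m :: ('a skew, 'm) module set)"
  define r where "r = {(E, F). E \<in> A \<and> F \<in> A \<and> module_isomorphic (U_ring M U) E F}"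
  have Irred: "(Irred scale M W U m :: ('a skew, 'm) module set set) = A // r"
    by (simp add: Irred_def A_def r_def)
  show ?thesis
  \<comment> \<open>The residue field is computed from a member of \<open>A\<close>, so the case
    without modules is split off.\<close>
  proof (cases "A = {}")
    case True
    then show ?thesis
      by (simp add: Irred quotient_def)
  next
    case False
    have A: "left_module (U_ring M U) E" "irreducible_module (U_ring M U) E"
      "\<And>v. v \<in> carrier E \<Longrightarrow> finite_dim_k scale E ((\<lambda>\<gamma>. Gamma_emb \<gamma> \<odot>\<^bsub>E\<^esub> v) ` Gamma W)"
      "weight_space W E m \<noteq> {\<zero>\<^bsub>E\<^esub>}" if "E \<in> A" for E
      using that by (auto simp: A_def irred_HC_modules_def harish_chandra_module_def module_support_def)
    have wv: "\<exists>v. weight_vector E v \<and> v \<noteq> \<zero>\<^bsub>E\<^esub>" if "E \<in> A" for E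
      using exists_weight_vector[OF A(1,4)[OF that]] .
    have residue: "\<exists>c. \<gamma> - scale c 1 \<in> m" if \<gamma>: "\<gamma> \<in> Gamma W" for \<gamma>
    proof -
      obtain E where E: "E \<in> A"
        using False by blast
      obtain v where v: "weight_vector E v" "v \<noteq> \<zero>\<^bsub>E\<^esub>"
        using wv[OF E] by blast
      then have "v \<in> carrier E"
        by (simp add: weight_vector_def)
      then obtain G where "finite G" "span G \<subseteq> Gamma W" "\<And>\<gamma>. \<gamma> \<in> Gamma W \<Longrightarrow> \<exists>\<beta>\<in>span G. \<gamma> - \<beta> \<in> m"
        using Gamma_spanned_modulo_m[OF A(1)[OF E] v A(3)[OF E]] by metis
      then show ?thesis
        using residue_field_algebraic[of G \<gamma>] residue_field_trivial[OF \<gamma>] \<gamma> by metis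
    qed
    obtain T where T: "finite T" "T \<subseteq> U" "U0 \<subseteq> mod_span (Gamma_ring W) (right_KK M W Gamma_emb) T"
      by (rule U0_finitely_generated)
    have span: "\<exists>u'\<in>skew.span T. \<forall>(E :: ('a skew, 'm) module) v.
        weight_vector E v \<longrightarrow> u \<odot>\<^bsub>E\<^esub> v = u' \<odot>\<^bsub>E\<^esub> v" if "u \<in> U0" for u
      using residue T(2,3) that by (rule U0_span)
    have fd: "finite_dim_k scale E (weight_space W E m)" if E: "E \<in> A" for E
    proof -
      obtain v where v: "weight_vector E v" "v \<noteq> \<zero>\<^bsub>E\<^esub>"
        using wv[OF E] by blast
      show ?thesis
        by (rule finite_dim_weight_space[OF A(1,2)[OF E] v T(1,2)]) (use span v(1) in blast)
    qed
    have classes_subset: "r `` {E} \<subseteq> r `` {F}" if "F \<in> A" "module_isomorphic (U_ring M U) F E" for E F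
      unfolding r_def using that(1) module_isomorphic_trans[OF that(2)] by blast
    have classes: "r `` {E} = r `` {F}" if "E \<in> A" "F \<in> A" "module_isomorphic (U_ring M U) E F" for E F
      using classes_subset[OF that(1,3)]
        classes_subset[OF that(2) module_isomorphic_sym[OF A(1)[OF that(1)] that(3)]] by blast
    \<comment> \<open>Representatives of distinct classes are pairwise non-isomorphic, so the count
      of irreducible modules applies to them.\<close>
    have bound: "card \<C> \<le> card T" if X: "\<C> \<subseteq> A // r" "finite \<C>" for \<C>
    proof -
      have "\<forall>C\<in>\<C>. \<exists>E. E \<in> A \<and> C = r `` {E}"
        using X(1) by (auto simp: quotient_def)
      then obtain f where f: "\<And>C. C \<in> \<C> \<Longrightarrow> f C \<in> A \<and> C = r `` {f C}"
        by metis
      have inj: "inj_on f \<C>"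
        using f by (metis inj_onI)
      have "card (f ` \<C>) \<le> card T"
      proof (rule card_nonisomorphic_irreducibles[OF T(1,2) span])
        show "\<not> module_isomorphic (U_ring M U) E F" if EF: "E \<in> f ` \<C>" "F \<in> f ` \<C>" "E \<noteq> F" for E F
        proof
          assume iso: "module_isomorphic (U_ring M U) E F"
          obtain C D where CD: "C \<in> \<C>" "D \<in> \<C>" "E = f C" "F = f D"
            using EF(1,2) by blast
          have "C = D"
            using f[OF CD(1)] f[OF CD(2)] classes[OF _ _ iso] unfolding CD(3,4) by simp
          then show False
            using EF(3) CD by simp
        qed
      qed (use X(2) f A(2) wv in auto)
      then show ?thesis
        using card_image[OF inj] by simp
    qed
    have "finite (A // r)"
      using finite_if_finite_subsets_card_bdd[OF bound] by blast
    moreover have "C \<subseteq> A" if "C \<in> A // r" for C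
      using that by (auto simp: quotient_def r_def)
    ultimately show ?thesis
      using fd by (auto simp: Irred)
  qed
qed

end

theorem theorem4p12:
  fixes scale :: "'k::alg_closed_field \<Rightarrow> 'a::idom \<Rightarrow> 'a"
    and M W :: "('a \<Rightarrow> 'a) set"
    and U :: "'a skew set"
    and m P :: "'a set"
  assumes "galois_ring_setting scale M W"
    and "affine_algebra scale"
    and "subgroup M (alg_aut scale)"
    and "galois_order scale M W U"
    and "maximalideal m (Gamma_ring W)"
    and "maximalideal P (ring_of_type_algebra :: 'a ring)"
    and "P \<inter> Gamma W = m"
    and "finite (stabilizer_in M P)"
  shows "finite (Irred scale M W U m :: ('a skew, 'm) module set set) \<and>
    (\<forall>C \<in> (Irred scale M W U m :: ('a skew, 'm) module set set). \<forall>E \<in> C.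
       finite_dim_k scale E (weight_space W E m))"
proof -
  interpret galois_ring_setting scale M W
    by fact
  interpret galois_order_at scale M W U m P
    by (intro galois_order_at.intro galois_order_at_axioms.intro) (fact assms)+
  show ?thesis
    by (rule finite_Irred_and_weight_space)
qed

end
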